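(* For every $n\in\mathbb{N}$ there exist a metric graph $\Gamma$, a point $q\in\Gamma$, a divisor $D$ on $\Gamma$ with $D(p)\ge 0$ for all $p\in\Gamma$ with $p\neq q$, and a (transfinite) greedy reduction of $D$ with respect to $q$ which takes at least $\omega^n$ steps.
   Context: A metric graph $\Gamma$ is a compact connected metric space obtained from a finite edge-weighted graph by viewing each edge of weight $w>0$ as a segment of length $w$ (with the path metric). The degree of a point $p\in\Gamma$ is the number of tangent directions at $p$; a combinatorial vertex is a point of degree other than $2$. A divisor $D$ on $\Gamma$ is a formal integer combination of points of $\Gamma$ with finitely many nonzero coefficients; $D(p)$ is the coefficient (number of chips) at $p$. Fix $q\in\Gamma$. A (basic) firing $f$ towards $q$ of length $\epsilon=\epsilon(f)>0$ is given by two disjoint nonempty connected closed subsets $X,Y\subset\Gamma$ with $q\in X$ such that $Z=\Gamma\setminus(X\cup Y)$ is a disjoint union of finitely many open segments of length $\epsilon$, each having one endpoint in $X$ and the other endpoint in $Y$. The associated function $f:\Gamma\to\mathbb{R}$ is the piecewise affine function equal to $0$ on $X$, equal to $\epsilon$ on $Y$, and of slope $1$ on each segment of $Z$ in the direction from $X$ to $Y$. The divisor $Q(f)$ is $\sum_{I}\big((y_I)-(x_I)\big)$, the sum being over the segments $I$ of $Z$, where $x_I\in X$ and $y_I\in Y$ are the endpoints of $I$. Thus passing from $D$ to $D-Q(f)$ pushes one chip along each segment of the cut $Z$ a distance $\epsilon$ from $Y$ to $X$, i.e. towards $q$. For a divisor $D$ with $D(p)\ge0$ for all $p\neq q$, the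 firing $f$ is legal for $D$ if $D-Q(f)$ is also nonnegative at all points other than $q$. It is a maximal legal firing for $D$ if it is legal and its length is maximum for the given cut, i.e. there is no legal firing towards $q$ for $D$ with the same set $Y$ and strictly larger length (equivalently, at least one of the pushed chips hits a combinatorial vertex or $q$, and so cannot be pushed further without choosing a different cut). Transfinite greedy reduction: for an ordinal $\alpha$, a greedy reduction of $D$ with respect to $q$ taking $\alpha$ steps is a family of divisors $(D_\beta)_{\beta\le\alpha}$ with $D_0=D$; for every $\beta<\alpha$, $D_{\beta+1}=D_\beta-Q(f_\beta)$ where $f_\beta$ is a maximal legal firing towards $q$ for $D_\beta$; and for every limit ordinal $\lambda\le\alpha$, $D_\lambda$ is the limit of $D_\beta$ as $\beta\to\lambda$, $\beta<\lambda$. Convergence of divisors is meant as follows: with $N=\max(0,-D(q))$ every $D_\beta+N(q)$ is a sum of a fixed number $m$ of points of $\Gamma$ (chips), and $D_\beta\to D_\lambda$ means that the chips can be labelled, $D_\beta+N(q)=\sum_{j=1}^m(x_{\beta,j})$ and $D_\lambda+N(q)=\sum_{j=1}^m(x_{\lambda,j})$, so that $x_{\beta,j}\to x_{\lambda,j}$ in $\Gamma$ for each $j$. *)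

theory Defs
  imports "HOL-Analysis.Analysis" "HOL-Library.Poly_Mapping" "HOL-Library.Disjoint_Sets"
begin

section \<open>Metric graphs\<close>

text \<open>Loops and multiple edges are allowed. The orientation of an edge only fixes its
  parametrisation by the interval from \<open>0\<close> to its length.\<close>

record ('v, 'e) wgraph =
  verts :: "'v set"
  edges :: "'e set"
  tail :: "'e \<Rightarrow> 'v"
  head :: "'e \<Rightarrow> 'v"
  len :: "'e \<Rightarrow> real"

definition adjacency :: "('v, 'e) wgraph \<Rightarrow> 'v rel" where
  "adjacency G = (\<Union>e\<in>edges G. {(tail G e, head G e), (head G e, tail G e)})"

definition metric_graph :: "('v, 'e) wgraph \<Rightarrow> bool" where
  "metric_graph G \<longleftrightarrow>
     finite (verts G) \<and> verts G \<noteq> {} \<and> finite (edges G) \<and>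
     (\<forall>e\<in>edges G. tail G e \<in> verts G \<and> head G e \<in> verts G \<and> len G e > 0) \<and>
     (\<forall>u\<in>verts G. \<forall>v\<in>verts G. (u, v) \<in> (adjacency G)\<^sup>*)"

datatype ('v, 'e) point = Vertex 'v | Inner 'e real

definition points :: "('v, 'e) wgraph \<Rightarrow> ('v, 'e) point set" where
  "points G = Vertex ` verts G \<union> {Inner e t | e t. e \<in> edges G \<and> 0 < t \<and> t < len G e}"

definition edge_point :: "('v, 'e) wgraph \<Rightarrow> 'e \<Rightarrow> real \<Rightarrow> ('v, 'e) point" where
  "edge_point G e t =
     (if t = 0 then Vertex (tail G e) else if t = len G e then Vertex (head G e) else Inner e t)"

text \<open>\<open>route G p L p'\<close>: there is a route of total length \<open>L\<close> from \<open>p\<close> to \<open>p'\<close> made of finitely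
  many moves, each inside a single closed edge.\<close>

inductive route :: "('v, 'e) wgraph \<Rightarrow> ('v, 'e) point \<Rightarrow> real \<Rightarrow> ('v, 'e) point \<Rightarrow> bool"
  for G p where
  route_refl: "p \<in> points G \<Longrightarrow> route G p 0 p"
| route_step: "\<lbrakk>route G p L (edge_point G e s); e \<in> edges G; s \<in> {0..len G e}; t \<in> {0..len G e}\<rbrakk>
    \<Longrightarrow> route G p (L + \<bar>s - t\<bar>) (edge_point G e t)"

definition path_dist :: "('v, 'e) wgraph \<Rightarrow> ('v, 'e) point \<Rightarrow> ('v, 'e) point \<Rightarrow> real" where
  "path_dist G p p' =
     (if p \<in> points G \<and> p' \<in> points G then Inf {L. route G p L p'} else 0)"

lemma route_nonneg: "route G p L p' \<Longrightarrow> L \<ge> 0"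
  by (induction rule: route.induct) auto

lemma route_trans:
  assumes "route G p2 L' p3" "route G p1 L p2"
  shows "route G p1 (L + L') p3"
  using assms
proof (induction rule: route.induct)
  case route_refl then show ?case by simp
next
  case (route_step L' e s t)
  have "route G p1 ((L + L') + \<bar>s - t\<bar>) (edge_point G e t)"
    by (rule route.route_step) (use route_step in auto)
  then show ?case by (simp add: add.assoc)
qed

lemma edge_point_in_points:
  "metric_graph G \<Longrightarrow> e \<in> edges G \<Longrightarrow> t \<in> {0..len G e} \<Longrightarrow> edge_point G e t \<in> points G"
  by (auto simp: metric_graph_def edge_point_def points_def)

lemma route_edge:
  assumes "metric_graph G" "e \<in> edges G" "s \<in> {0..len G e}" "t \<in> {0..len G e}"
  shows "route G (edge_point G e s) \<bar>s - t\<bar> (edge_point G e t)"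
  using route_step[OF route_refl[OF edge_point_in_points[OF assms(1,2,3)]] assms(2,3,4)] by simp

lemma route_sym:
  assumes "metric_graph G" "route G p L p'" shows "route G p' L p"
  using assms(2)
proof (induction rule: route.induct)
  case route_refl then show ?case by (rule route.route_refl)
next
  case (route_step L e s t)
  from route_trans[OF route_step.IH route_edge[OF assms(1) route_step.hyps(2,4,3)]]
  show ?case by (simp add: abs_minus_commute add.commute)
qed

lemma route_to_vertex:
  assumes "metric_graph G" "p \<in> points G"
  shows "\<exists>v\<in>verts G. \<exists>L. route G p L (Vertex v)"
proof (cases p)
  case (Vertex v)
  then show ?thesis using assms by (auto simp: points_def intro!: exI[of _ 0] bexI[of _ v] route_refl)
next
  case (Inner e t)
  then have e: "e \<in> edges G" "0 < t" "t < len G e" using assms(2) by (auto simp: points_def)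
  have "route G (edge_point G e t) \<bar>t - 0\<bar> (edge_point G e 0)"
    by (rule route_edge) (use e assms in auto)
  then have "route G p \<bar>t - 0\<bar> (Vertex (tail G e))"
    using e Inner by (simp add: edge_point_def)
  moreover have "tail G e \<in> verts G" using assms(1) e by (auto simp: metric_graph_def)
  ultimately show ?thesis by blast
qed

lemma route_vertices:
  assumes "metric_graph G" "u \<in> verts G" "(u, v) \<in> (adjacency G)\<^sup>*"
  shows "\<exists>L. route G (Vertex u) L (Vertex v)"
  using assms(3)
proof (induction rule: rtrancl_induct)
  case base then show ?case using assms by (auto simp: points_def intro!: exI[of _ 0] route_refl)
next
  case (step y z)
  then obtain L e where L: "route G (Vertex u) L (Vertex y)" and e: "e \<in> edges G"
    "(y,z) = (tail G e, head G e) \<or> (y,z) = (head G e, tail G e)" by (auto simp: adjacency_def)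
  have l: "len G e > 0" using assms(1) e by (auto simp: metric_graph_def)
  have 1: "route G (edge_point G e 0) \<bar>0 - len G e\<bar> (edge_point G e (len G e))"
    by (rule route_edge) (use e l assms in auto)
  have 2: "route G (edge_point G e (len G e)) \<bar>len G e - 0\<bar> (edge_point G e 0)"
    by (rule route_edge) (use e l assms in auto)
  have 3: "edge_point G e 0 = Vertex (tail G e)" "edge_point G e (len G e) = Vertex (head G e)"
    using l by (auto simp: edge_point_def)
  from e(2) show ?case using 1 2 L unfolding 3 by (auto dest: route_trans)
qed

lemma route_exists:
  assumes "metric_graph G" "p \<in> points G" "p' \<in> points G"
  shows "\<exists>L. route G p L p'"
proof -
  obtain u L v L' where "u \<in> verts G" "route G p L (Vertex u)" "v \<in> verts G" "route G p' L' (Vertex v)"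
    using route_to_vertex assms by metis
  moreover from this obtain L'' where "route G (Vertex u) L'' (Vertex v)"
    using route_vertices[OF assms(1)] assms(1) by (meson metric_graph_def)
  ultimately show ?thesis by (meson route_trans route_sym[OF assms(1)])
qed

lemma route_lipschitz:
  assumes "\<And>e s t. e \<in> edges G \<Longrightarrow> s \<in> {0..len G e} \<Longrightarrow> t \<in> {0..len G e} \<Longrightarrow>
     h (edge_point G e t) \<le> h (edge_point G e s) + \<bar>s - t\<bar>"
   and "route G p L p'"
  shows "h p' \<le> h p + (L::real)"
  using assms(2) 
proof (induction rule: route.induct)
  case (route_step L e s t)
  then show ?case using assms(1)[of e s t] by simp
qed simp

lemma min_add:
  fixes a b c d k :: real
  shows "a \<le> c + k \<Longrightarrow> b \<le> d + k \<Longrightarrow> min a b \<le> min c d + k"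
  by (simp add: min_def)

lemma graph_separation:
  assumes G: "metric_graph G" and "p \<in> points G" "p' \<in> points G" "p \<noteq> p'"
  shows "\<exists>h. h p = (0::real) \<and> h p' > 0 \<and> (\<forall>e\<in>edges G. \<forall>s\<in>{0..len G e}. \<forall>t\<in>{0..len G e}.
     h (edge_point G e t) \<le> h (edge_point G e s) + \<bar>s - t\<bar>)"
proof (cases p)
  case (Inner e0 t0)
  then have e: "e0 \<in> edges G" "0 < t0" "t0 < len G e0" using assms(2) by (auto simp: points_def)
  define c where "c = min t0 (len G e0 - t0)"
  define h where "h x = (case x of Vertex _ \<Rightarrow> c | Inner e t \<Rightarrow> if e = e0 then min c \<bar>t - t0\<bar> else c)"
    for x :: "('a,'b) point"
  have c: "c > 0" using e by (auto simp: c_def)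
  have h: "h (edge_point G e t) = (if e = e0 then min c \<bar>t - t0\<bar> else c)" 
    if "e \<in> edges G" "t \<in> {0..len G e}" for e t
    using that e by (auto simp: h_def edge_point_def c_def min_def)
  have "h p = 0" "h p' > 0"
    using Inner c assms(4) by (auto simp: h_def split: point.split)
  moreover have "h (edge_point G e t) \<le> h (edge_point G e s) + \<bar>s - t\<bar>"
    if "e \<in> edges G" "s \<in> {0..len G e}" "t \<in> {0..len G e}" for e s t
    unfolding h[OF that(1,2)] h[OF that(1,3)] using min_add[of c c "\<bar>s - t\<bar>" "\<bar>t - t0\<bar>" "\<bar>s - t0\<bar>"]
    by (cases "e = e0") auto
  ultimately show ?thesis by blast
next
  case (Vertex v)
  define m where "m = Min (insert 1 (len G ` edges G))"
  have fin: "finite (edges G)" and pos: "\<And>e. e \<in> edges G \<Longrightarrow> len G e > 0"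
    using G by (auto simp: metric_graph_def)
  have m: "m > 0" "\<And>e. e \<in> edges G \<Longrightarrow> m \<le> len G e" using fin pos by (auto simp: m_def)
  define g where "g e t = min m (min (if tail G e = v then t else m) (if head G e = v then len G e - t else m))" for e t
  define h where "h x = (case x of Vertex u \<Rightarrow> if u = v then 0 else m | Inner e t \<Rightarrow> g e t)"
    for x :: "('a,'b) point"
  have h: "h (edge_point G e t) = g e t" 
    if "e \<in> edges G" "t \<in> {0..len G e}" for e t
    using that m(1) m(2)[OF that(1)] by (auto simp: h_def g_def edge_point_def)
  have "h p' > 0" using assms(3,4) m Vertex by (auto simp: h_def g_def points_def split: if_splits)
  moreover have "h (edge_point G e t) \<le> h (edge_point G e s) + \<bar>s - t\<bar>"
    if "e\<in>edges G" "s\<in>{0..len G e}" "t\<in>{0..len G e}" for e s t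
    unfolding h[OF that(1,2)] h[OF that(1,3)] g_def by (intro min_add) (use that m in auto)
  moreover have "h p = 0" using Vertex by (simp add: h_def)
  ultimately show ?thesis by blast
qed

lemma route_set: "bdd_below {L. route G p L p'}"
  by (rule bdd_belowI[of _ 0]) (auto dest: route_nonneg)

lemma path_dist_le: "p \<in> points G \<Longrightarrow> p' \<in> points G \<Longrightarrow> route G p L p' \<Longrightarrow> path_dist G p p' \<le> L"
  by (auto simp: path_dist_def intro!: cInf_lower route_set)

lemma path_dist_ge:
  assumes "metric_graph G" "p \<in> points G" "p' \<in> points G" "\<And>L. route G p L p' \<Longrightarrow> c \<le> L"
  shows "c \<le> path_dist G p p'"
  using assms route_exists[OF assms(1-3)] by (auto simp: path_dist_def intro!: cInf_greatest)

theorem Metric_space_graph: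
  assumes G: "metric_graph G"
  shows "Metric_space (points G) (path_dist G)"
proof
  fix p p'
  have "(\<lambda>L. route G p L p') = (\<lambda>L. route G p' L p)" using route_sym[OF G] by blast
  then show "path_dist G p p' = path_dist G p' p" by (simp add: path_dist_def)
  show "0 \<le> path_dist G p p'"
    using path_dist_ge[OF G, of p p' 0] route_nonneg by (auto simp: path_dist_def)
next
  fix p p' assume p: "p \<in> points G" "p' \<in> points G"
  show "path_dist G p p' = 0 \<longleftrightarrow> p = p'"
  proof
    assume eq: "path_dist G p p' = 0"
    show "p = p'"
    proof (rule ccontr)
      assume "p \<noteq> p'"
      from graph_separation[OF G p this] obtain h where h: "h p = (0::real)" "h p' > 0" 
        "\<And>e s t. e \<in> edges G \<Longrightarrow> s \<in> {0..len G e} \<Longrightarrow> t \<in> {0..len G e} \<Longrightarrow>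
     h (edge_point G e t) \<le> h (edge_point G e s) + \<bar>s - t\<bar>" by blast
      have "h p' \<le> path_dist G p p'"
        using route_lipschitz[of G h, OF h(3)] h(1) by (intro path_dist_ge G p) fastforce
      with eq h(2) show False by simp
    qed
  next
    assume "p = p'" then show "path_dist G p p' = 0"
      using path_dist_le[OF p, of 0] path_dist_ge[OF G p, of 0] p route_refl[of p G] route_nonneg by force
  qed
next
  fix p1 p2 p3 assume p: "p1 \<in> points G" "p2 \<in> points G" "p3 \<in> points G"
  have "path_dist G p1 p3 - L \<le> path_dist G p2 p3" if "route G p1 L p2" for L
    using path_dist_le[OF p(1,3) route_trans[OF _ that]] by (intro path_dist_ge G p) force
  then have "path_dist G p1 p3 - path_dist G p2 p3 \<le> path_dist G p1 p2"
    by (intro path_dist_ge G p) force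
  then show "path_dist G p1 p3 \<le> path_dist G p1 p2 + path_dist G p2 p3" by simp
qed

abbreviation graph_topology :: "('v, 'e) wgraph \<Rightarrow> ('v, 'e) point topology" where
  "graph_topology G \<equiv> Metric_space.mtopology (points G) (path_dist G)"


section \<open>Divisors and firings\<close>

type_synonym ('v, 'e) divisor = "('v, 'e) point \<Rightarrow>\<^sub>0 int"

definition is_divisor :: "('v, 'e) wgraph \<Rightarrow> ('v, 'e) divisor \<Rightarrow> bool" where
  "is_divisor G D \<longleftrightarrow> Poly_Mapping.keys D \<subseteq> points G"

definition effective_off ::
    "('v, 'e) wgraph \<Rightarrow> ('v, 'e) point \<Rightarrow> ('v, 'e) divisor \<Rightarrow> bool" where
  "effective_off G q D \<longleftrightarrow> (\<forall>p\<in>points G. p \<noteq> q \<longrightarrow> Poly_Mapping.lookup D p \<ge> 0)"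

text \<open>An arc is a unit-speed parametrisation of a segment: it is injective and a local isometry.
  A segment of the graph need not be a geodesic for the path metric, so a global isometry would
  be too strong.\<close>

definition unit_arc ::
    "('v, 'e) wgraph \<Rightarrow> real \<Rightarrow> (real \<Rightarrow> ('v, 'e) point) \<Rightarrow> bool" where
  "unit_arc G \<epsilon> \<gamma> \<longleftrightarrow>
     \<gamma> ` {0..\<epsilon>} \<subseteq> points G \<and> inj_on \<gamma> {0..\<epsilon>} \<and>
     (\<forall>t\<in>{0..\<epsilon>}. \<exists>\<delta>>0. \<forall>s\<in>{0..\<epsilon>}. \<forall>s'\<in>{0..\<epsilon>}.
        \<bar>s - t\<bar> < \<delta> \<and> \<bar>s' - t\<bar> < \<delta> \<longrightarrow> path_dist G (\<gamma> s) (\<gamma> s') = \<bar>s - s'\<bar>)"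

text \<open>The open segments forming the cut are \<open>\<gamma> ` {0<..<\<epsilon>}\<close> for \<open>\<gamma>\<close> in \<open>segs\<close>, each parametrised
  from its endpoint in the near side \<open>X\<close> to its endpoint in the far side \<open>Y\<close>. Up to
  reparametrisation outside \<open>{0..\<epsilon>}\<close> they are determined by \<open>X\<close> and \<open>Y\<close>, being the connected
  components of the complement of \<open>X \<union> Y\<close>.\<close>

record ('v, 'e) firing =
  near :: "('v, 'e) point set"
  far :: "('v, 'e) point set"
  flen :: real
  segs :: "(real \<Rightarrow> ('v, 'e) point) set"

definition is_firing ::
    "('v, 'e) wgraph \<Rightarrow> ('v, 'e) point \<Rightarrow> ('v, 'e) firing \<Rightarrow> bool" where
  "is_firing G q f \<longleftrightarrow>
     near f \<inter> far f = {} \<and> near f \<noteq> {} \<and> far f \<noteq> {} \<and>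
     closedin (graph_topology G) (near f) \<and> closedin (graph_topology G) (far f) \<and>
     connectedin (graph_topology G) (near f) \<and> connectedin (graph_topology G) (far f) \<and>
     q \<in> near f \<and> flen f > 0 \<and>
     finite (segs f) \<and>
     (\<forall>\<gamma>\<in>segs f. unit_arc G (flen f) \<gamma> \<and> \<gamma> 0 \<in> near f \<and> \<gamma> (flen f) \<in> far f) \<and>
     disjoint_family_on (\<lambda>\<gamma>. \<gamma> ` {0<..<flen f}) (segs f) \<and>
     points G - (near f \<union> far f) = (\<Union>\<gamma>\<in>segs f. \<gamma> ` {0<..<flen f})"

definition firing_divisor :: "('v, 'e) firing \<Rightarrow> ('v, 'e) divisor" where
  "firing_divisor f = (\<Sum>\<gamma>\<in>segs f. frag_of (\<gamma> (flen f)) - frag_of (\<gamma> 0))"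

definition legal_firing ::
    "('v, 'e) wgraph \<Rightarrow> ('v, 'e) point \<Rightarrow> ('v, 'e) divisor \<Rightarrow> ('v, 'e) firing \<Rightarrow> bool" where
  "legal_firing G q D f \<longleftrightarrow> is_firing G q f \<and> effective_off G q (D - firing_divisor f)"

definition maximal_legal_firing ::
    "('v, 'e) wgraph \<Rightarrow> ('v, 'e) point \<Rightarrow> ('v, 'e) divisor \<Rightarrow> ('v, 'e) firing \<Rightarrow> bool" where
  "maximal_legal_firing G q D f \<longleftrightarrow>
     legal_firing G q D f \<and>
     \<not> (\<exists>f'. legal_firing G q D f' \<and> far f' = far f \<and> flen f' > flen f)"


section \<open>Ordinals and transfinite greedy reductions\<close>

text \<open>An ordinal \<open>\<alpha>\<close> is represented by a well-order \<open>r\<close>, whose field stands for the set of ordinals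
  below \<open>\<alpha>\<close>; ordinals are compared by \<open>ordLeq\<close>. In \<open>osucc r\<close>, which represents \<open>\<alpha> + 1\<close>, the element
  \<open>None\<close> stands for \<open>\<alpha>\<close> itself.\<close>

definition osucc :: "'i rel \<Rightarrow> 'i option rel" where
  "osucc r = {(Some x, Some y) | x y. (x, y) \<in> r} \<union>
     {(a, None) | a. a \<in> insert None (Some ` Field r)}"

definition is_succ :: "'i rel \<Rightarrow> 'i \<Rightarrow> 'i \<Rightarrow> bool" where
  "is_succ r b b' \<longleftrightarrow> b \<in> underS r b' \<and> (\<forall>c. b \<in> underS r c \<longrightarrow> (b', c) \<in> r)"

definition is_zero :: "'i rel \<Rightarrow> 'i \<Rightarrow> bool" where
  "is_zero r b \<longleftrightarrow> b \<in> Field r \<and> underS r b = {}"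

definition is_limit :: "'i rel \<Rightarrow> 'i \<Rightarrow> bool" where
  "is_limit r b \<longleftrightarrow> b \<in> Field r \<and> \<not> is_zero r b \<and> \<not> (\<exists>a. is_succ r a b)"

text \<open>The recursion is \<open>\<omega>^0 = 1\<close>, \<open>\<omega>^(n+1) = \<omega>^n \<cdot> \<omega>\<close>: the head of a list of length \<open>n + 1\<close>
  says in which of the \<open>\<omega>\<close> consecutive copies of \<open>\<omega>^n\<close> its tail is placed.\<close>

primrec omega_pow :: "nat \<Rightarrow> nat list rel" where
  "omega_pow 0 = {([], [])}"
| "omega_pow (Suc n) =
     {(i # xs, j # ys) | i j xs ys. xs \<in> Field (omega_pow n) \<and> ys \<in> Field (omega_pow n) \<and>
        (i < j \<or> i = j \<and> (xs, ys) \<in> omega_pow n)}"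

lemma Field_omega_pow: "Field (omega_pow n) = {xs. length xs = n}"
proof (induction n)
  case (Suc n)
  have refl: "(xs, xs) \<in> omega_pow n" if "length xs = n" for xs
    using that
  proof (induction n arbitrary: xs)
    case (Suc n)
    then show ?case using FieldI1[OF Suc.IH] by (auto simp: length_Suc_conv)
  qed auto
  show ?case
  proof (intro equalityI subsetI)
    fix ys assume "ys \<in> Field (omega_pow (Suc n))"
    then show "ys \<in> {xs. length xs = Suc n}" using Suc by (auto simp: Field_def)
  next
    fix ys :: "nat list" assume "ys \<in> {xs. length xs = Suc n}"
    then obtain y zs where "ys = y # zs" "length zs = n" by (auto simp: length_Suc_conv)
    then have "(ys, y # zs) \<in> omega_pow (Suc n)" using Suc refl[of zs] FieldI1[OF refl[of zs]] by auto
    then show "ys \<in> Field (omega_pow (Suc n))" by (rule FieldI1)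
  qed
qed (auto simp: Field_def)

lemma Well_order_omega_pow: "Well_order (omega_pow n)"
proof (induction n)
  case 0
  have "omega_pow 0 - Id = {}" by auto
  then show ?case
    unfolding well_order_on_def linear_order_on_def partial_order_on_def preorder_on_def
    by (auto simp: Field_def refl_on_def trans_def antisym_def total_on_def)
next
  case (Suc n)
  define r where "r = omega_pow n"
  define F where "F = Field r"
  have r: "refl_on F r" "trans r" "antisym r" "total_on F r" "wf (r - Id)"
    using Suc by (auto simp: r_def F_def well_order_on_def linear_order_on_def partial_order_on_def
        preorder_on_def)
  have tot: "x = y \<or> (x, y) \<in> r \<or> (y, x) \<in> r" if "x \<in> F" "y \<in> F" for x y
    using r(4) that by (auto simp: total_on_def)
  have eq: "omega_pow (Suc n) =
    {(i # xs, j # ys) | i j xs ys. xs \<in> F \<and> ys \<in> F \<and> (i < j \<or> i = j \<and> (xs, ys) \<in> r)}"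
    by (simp add: r_def F_def)
  have F: "Field (omega_pow (Suc n)) = {i # xs | i xs. xs \<in> F}"
    unfolding Field_omega_pow F_def r_def by (auto simp: length_Suc_conv)
  have "wf (omega_pow (Suc n) - Id)"
  proof (rule wf_subset)
    show "wf (inv_image (less_than <*lex*> (r - Id)) (\<lambda>l. (hd l, tl l)))"
      using r(5) by (intro wf_inv_image wf_lex_prod) auto
    show "omega_pow (Suc n) - Id \<subseteq> inv_image (less_than <*lex*> (r - Id)) (\<lambda>l. (hd l, tl l))"
      unfolding eq by auto
  qed
  moreover have "trans (omega_pow (Suc n))"
    unfolding eq using r(2) by (intro transI) (auto dest: transD)
  moreover have "antisym (omega_pow (Suc n))"
    unfolding eq using r(3) by (intro antisymI) (auto dest: antisymD)
  moreover have "refl_on (Field (omega_pow (Suc n))) (omega_pow (Suc n))"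
    unfolding F unfolding eq using r(1) by (auto simp: refl_on_def)
  moreover have "total_on (Field (omega_pow (Suc n))) (omega_pow (Suc n))"
    unfolding F unfolding eq by (auto simp: total_on_def) (use tot in blast)
  moreover have "omega_pow (Suc n) \<subseteq> Field (omega_pow (Suc n)) \<times> Field (omega_pow (Suc n))"
    by (auto intro: FieldI1 FieldI2 simp del: omega_pow.simps)
  ultimately show ?case
    unfolding well_order_on_def linear_order_on_def partial_order_on_def preorder_on_def by blast
qed

lemma Field_osucc: "Field (osucc r) = insert None (Some ` Field r)"
proof (intro equalityI subsetI)
  fix x assume "x \<in> insert None (Some ` Field r)"
  then have "(x, None) \<in> osucc r" by (auto simp: osucc_def)
  then show "x \<in> Field (osucc r)" by (rule FieldI1)
qed (auto simp: osucc_def Field_def)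

lemma Well_order_osucc:
  assumes "Well_order r"
  shows "Well_order (osucc r)"
proof -
  have r: "refl_on (Field r) r" "trans r" "antisym r" "total_on (Field r) r" "wf (r - Id)"
    using assms by (auto simp: well_order_on_def linear_order_on_def partial_order_on_def preorder_on_def)
  have "wf (osucc r - Id)"
  proof (rule wfUNIVI)
    fix P :: "_ option \<Rightarrow> bool" and x
    assume s: "\<forall>x. (\<forall>y. (y, x) \<in> osucc r - Id \<longrightarrow> P y) \<longrightarrow> P x"
    have S: "P (Some a)" for a
      using r(5)
    proof (induction a rule: wf_induct_rule)
      case (less a)
      show ?case by (rule s[rule_format]) (auto simp: osucc_def intro!: less)
    qed
    moreover have "P None" by (rule s[rule_format]) (auto simp: osucc_def S)
    ultimately show "P x" by (cases x) auto
  qed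
  moreover have "trans (osucc r)"
    using r(2) by (intro transI) (auto simp: osucc_def dest: transD intro: FieldI1)
  moreover have "antisym (osucc r)"
    using r(3) by (intro antisymI) (auto simp: osucc_def dest: antisymD)
  moreover have "refl_on (Field (osucc r)) (osucc r)" using r(1)
    unfolding Field_osucc by (auto simp: refl_on_def osucc_def)
  moreover have "total_on (Field (osucc r)) (osucc r)" using r(4)
    unfolding Field_osucc by (auto simp: total_on_def osucc_def)
  moreover have "osucc r \<subseteq> Field (osucc r) \<times> Field (osucc r)"
    by (auto intro: FieldI1 FieldI2)
  ultimately show ?thesis
    unfolding well_order_on_def linear_order_on_def partial_order_on_def preorder_on_def by blast
qed

text \<open>Convergence of the family \<open>Ds\<close> at \<open>l\<close>, after adding \<open>N\<close> chips at \<open>q\<close>: the \<open>m\<close> chips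
  \<open>x b 0, \<dots>, x b (m - 1)\<close> of each divisor can be labelled so that they converge one by one.\<close>

definition chips_converge ::
    "('v, 'e) wgraph \<Rightarrow> ('v, 'e) point \<Rightarrow> int \<Rightarrow> 'i rel \<Rightarrow> ('i \<Rightarrow> ('v, 'e) divisor) \<Rightarrow> 'i \<Rightarrow> bool" where
  "chips_converge G q N r Ds l \<longleftrightarrow>
     (\<exists>(m::nat) x.
        (\<forall>b \<in> insert l (underS r l). Ds b + frag_cmul N (frag_of q) = (\<Sum>j<m. frag_of (x b j))) \<and>
        (\<forall>j<m. \<forall>\<epsilon>>0. \<exists>b\<in>underS r l. \<forall>c\<in>underS r l.
           (b, c) \<in> r \<longrightarrow> path_dist G (x c j) (x l j) < \<epsilon>))"

definition greedy_reduction ::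
    "('v, 'e) wgraph \<Rightarrow> ('v, 'e) point \<Rightarrow> ('v, 'e) divisor \<Rightarrow> 'i rel \<Rightarrow>
     ('i option \<Rightarrow> ('v, 'e) divisor) \<Rightarrow> bool" where
  "greedy_reduction G q D \<alpha> Ds \<longleftrightarrow>
     Well_order \<alpha> \<and>
     (\<forall>b\<in>Field (osucc \<alpha>). is_divisor G (Ds b)) \<and>
     (\<forall>b. is_zero (osucc \<alpha>) b \<longrightarrow> Ds b = D) \<and>
     (\<forall>b b'. is_succ (osucc \<alpha>) b b' \<longrightarrow>
        (\<exists>f. maximal_legal_firing G q (Ds b) f \<and> Ds b' = Ds b - firing_divisor f)) \<and>
     (\<forall>l. is_limit (osucc \<alpha>) l \<longrightarrow>
        chips_converge G q (max 0 (- Poly_Mapping.lookup D q)) (osucc \<alpha>) Ds l)"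

end

(* On a complete graph with unit edge lengths and one chip per edge, a family of cut firings is
   described by a potential F on the vertices: firing S by eps adds eps to F on S, and the chip on
   the edge uv is displaced by F(u) - F(v). All chips except a few start in the middle of their edges
   and never get near a vertex. The few special edges are pairwise disjoint; the distances of their
   chips to one end are registers, and choosing S suitably one may subtract the minimum m of any
   chosen registers from all of them and add m to any other chosen registers. This is a maximal
   firing, as the chip of the minimal register reaches a vertex, where at least three edges meet.

   With rho^2 + rho = 1, the operation (a, b, c) := (a - b, 0, c + b) turns (x, rho x, 0) into
   (rho^2 x, 0, rho x), the initial state scaled by rho up to a permutation. Hence three registers
   run for omega steps of geometrically decreasing length, and end with all three at 0. For omega^(n+1)
   steps, three new registers do the same, but each round also loads a multiple of (1, rho, 0) into the
   registers of the omega^n machine, and then lets that machine run. The total length of all firings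
   is proportional to the initial x, so it can be made as small as needed. *)
theory Submission
  imports Defs
begin

text \<open>Maximality is the topological obstacle: a competing firing shares only the far side,
  while its near side and its segments are arbitrary. It is bounded by showing that no open segment
  passes through a point of degree at least 3; a segment near the far end of the blocking edge is
  then confined to that edge. Completeness is chosen because every nonempty vertex set then spans a
  connected part, so every \<open>S\<close> avoiding \<open>q\<close> may be fired. Disjointness of
  the special edges lets each of their ends be put into \<open>S\<close> independently. The
  basepoint \<open>q\<close> is vertex 0, which lies on no special edge and is never fired. The
  constant 1/2 is a budget: as long as all potentials stay in [0, 1/2], a chip starting in the
  middle of its edge stays on it. Potentials only increase and are bounded, so limit stages exist
  pointwise, and each chip converges along its own edge. The firings that load the lower machine
  cost no order type, since 1 + \<omega>^(n+1) = \<omega>^(n+1).\<close>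

section \<open>Complete graphs with unit edge lengths\<close>

lemma local_isometry_strict_mono:
  fixes g :: "real \<Rightarrow> real"
  assumes I: "connected I"
    and loc: "\<And>t. t \<in> I \<Longrightarrow> \<exists>\<delta>>0. \<forall>s\<in>I. \<bar>s - t\<bar> < \<delta> \<longrightarrow> \<bar>g s - g t\<bar> = \<bar>s - t\<bar>"
    and mono: "strict_mono_on I g"
    and st: "s \<in> I" "t \<in> I"
  shows "g s - g t = s - t"
proof -
  have "eventually (\<lambda>b. g a - a = g b - b) (at a within I)" if a: "a \<in> I" for a
  proof -
    obtain \<delta> where \<delta>: "\<delta> > 0" "\<And>s. s \<in> I \<Longrightarrow> \<bar>s - a\<bar> < \<delta> \<Longrightarrow> \<bar>g s - g a\<bar> = \<bar>s - a\<bar>"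
      using loc[OF a] by blast
    have "g a - a = g b - b" if "b \<in> I" "\<bar>b - a\<bar> < \<delta>" for b
      using \<delta>(2)[OF that] strict_mono_onD[OF mono a that(1)] strict_mono_onD[OF mono that(1) a]
      by (cases "a < b"; cases "b < a") auto
    then show ?thesis
      unfolding eventually_at using \<delta>(1) by (auto simp: dist_real_def)
  qed
  then show ?thesis
    using connected_local_const[OF I st, of "\<lambda>a. g a - a"] by auto
qed

text \<open>The hypothesis compares only with the centre \<open>t\<close>, so it admits folds such
  as the absolute value at 0. Injectivity excludes them: a continuous injective function on an
  interval is strictly monotone.\<close>

lemma injective_local_isometry:
  fixes g :: "real \<Rightarrow> real"
  assumes I: "is_interval I"
    and loc: "\<And>t. t \<in> I \<Longrightarrow> \<exists>\<delta>>0. \<forall>s\<in>I. \<bar>s - t\<bar> < \<delta> \<longrightarrow> \<bar>g s - g t\<bar> = \<bar>s - t\<bar>"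
    and inj: "inj_on g I"
    and st: "s \<in> I" "t \<in> I"
  shows "\<bar>g s - g t\<bar> = \<bar>s - t\<bar>"
proof -
  have "continuous_on I g"
    unfolding continuous_on_iff
  proof (intro ballI allI impI)
    fix x e :: real assume x: "x \<in> I" and e: "e > 0"
    obtain \<delta> where \<delta>: "\<delta> > 0" "\<forall>s\<in>I. \<bar>s - x\<bar> < \<delta> \<longrightarrow> \<bar>g s - g x\<bar> = \<bar>s - x\<bar>"
      using loc[OF x] by blast
    then show "\<exists>d>0. \<forall>x'\<in>I. dist x' x < d \<longrightarrow> dist (g x') (g x) < e"
      using e by (intro exI[of _ "min \<delta> e"]) (auto simp: dist_real_def)
  qed
  then have "strict_mono_on I g \<or> strict_antimono_on I g"
    using injective_eq_monotone_map[OF I] inj by blast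
  moreover have c: "connected I" using I is_interval_connected by blast
  moreover have "strict_mono_on I (\<lambda>x. - g x)" if "strict_antimono_on I g"
    using that by (auto simp: monotone_on_def)
  moreover have "\<exists>\<delta>>0. \<forall>s\<in>I. \<bar>s - t\<bar> < \<delta> \<longrightarrow> \<bar>- g s - - g t\<bar> = \<bar>s - t\<bar>" if "t \<in> I" for t
    using loc[OF that] by (simp add: abs_minus_commute)
  ultimately show ?thesis
    using local_isometry_strict_mono[OF c, of g, OF loc _ st]
      local_isometry_strict_mono[OF c, of "\<lambda>x. - g x" s t, OF _ _ st] by force
qed

text \<open>Arcs are isometric only locally. This makes edges and arcs continuous images of
  intervals, from which closedness and connectedness of their pieces follow.\<close>

lemma (in Metric_space) continuous_map_locally_Lipschitz:
  fixes f :: "real \<Rightarrow> 'a"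
  assumes "f ` T \<subseteq> M"
    and loc: "\<And>t. t \<in> T \<Longrightarrow> \<exists>\<delta>>0. \<forall>s\<in>T. \<bar>s - t\<bar> < \<delta> \<longrightarrow> d (f t) (f s) \<le> \<bar>s - t\<bar>"
  shows "continuous_map (top_of_set T) mtopology f"
  unfolding continuous_map_to_metric
proof (intro ballI allI impI)
  fix x e :: real assume x: "x \<in> topspace (top_of_set T)" and e: "e > 0"
  then obtain \<delta> where \<delta>: "\<delta> > 0" "\<And>s. s \<in> T \<Longrightarrow> \<bar>s - x\<bar> < \<delta> \<Longrightarrow> d (f x) (f s) \<le> \<bar>s - x\<bar>"
    using loc[of x] by auto
  define U where "U = T \<inter> ball x (min \<delta> e)"
  have "openin (top_of_set T) U" unfolding U_def by blast
  moreover have "x \<in> U" using x e \<delta> by (simp add: U_def)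
  moreover have "f y \<in> mball (f x) e" if "y \<in> U" for y
    using that x assms(1) \<delta>(2)[of y] by (auto simp: U_def dist_real_def abs_minus_commute)
  ultimately show "\<exists>U. openin (top_of_set T) U \<and> x \<in> U \<and> (\<forall>y\<in>U. f y \<in> mball (f x) e)" by blast
qed

text \<open>Four vertices give each vertex at least three branches. Unit lengths and the absence of
  loops make every edge a geodesic.\<close>

locale unit_complete_graph =
  fixes G :: "('v, 'e) wgraph"
  assumes finite_verts: "finite (verts G)" and finite_edges: "finite (edges G)"
    and card_verts: "4 \<le> card (verts G)"
    and tail_verts: "\<And>e. e \<in> edges G \<Longrightarrow> tail G e \<in> verts G"
    and head_verts: "\<And>e. e \<in> edges G \<Longrightarrow> head G e \<in> verts G"
    and no_loops: "\<And>e. e \<in> edges G \<Longrightarrow> tail G e \<noteq> head G e"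
    and unit_len: "\<And>e. e \<in> edges G \<Longrightarrow> len G e = 1"
    and complete: "\<And>u v. u \<in> verts G \<Longrightarrow> v \<in> verts G \<Longrightarrow> u \<noteq> v \<Longrightarrow>
      \<exists>e\<in>edges G. (tail G e, head G e) \<in> {(u, v), (v, u)}"
begin

lemma metric_graph: "metric_graph G"
proof -
  have "(u, v) \<in> (adjacency G)\<^sup>*" if uv: "u \<in> verts G" "v \<in> verts G" for u v
  proof (cases "u = v")
    case False
    then have "(u, v) \<in> adjacency G" using complete[OF uv] by (fastforce simp: adjacency_def)
    then show ?thesis by blast
  qed auto
  then show ?thesis
    using finite_verts finite_edges card_verts tail_verts head_verts unit_len
    by (auto simp: metric_graph_def)
qed

sublocale Metric_space "points G" "path_dist G"
  by (rule Metric_space_graph[OF metric_graph])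

lemma openin_compl: "closedin mtopology C \<Longrightarrow> openin mtopology (points G - C)"
  by (simp add: closedin_def)

lemma edge_point_points: "e \<in> edges G \<Longrightarrow> t \<in> {0..1} \<Longrightarrow> edge_point G e t \<in> points G"
  using edge_point_in_points[OF metric_graph] unit_len by auto

lemma edge_point_simps [simp]:
  "edge_point G e 0 = Vertex (tail G e)"
  "e \<in> edges G \<Longrightarrow> edge_point G e 1 = Vertex (head G e)"
  "e \<in> edges G \<Longrightarrow> t \<in> {0<..<1} \<Longrightarrow> edge_point G e t = Inner e t"
  using unit_len by (auto simp: edge_point_def)

lemma Vertex_points: "v \<in> verts G \<Longrightarrow> Vertex v \<in> points G"
  by (simp add: points_def)

lemma Inner_points: "e \<in> edges G \<Longrightarrow> t \<in> {0<..<1} \<Longrightarrow> Inner e t \<in> points G"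
  using unit_len by (auto simp: points_def)

lemma points_cases:
  assumes "p \<in> points G"
  obtains v where "v \<in> verts G" "p = Vertex v"
  | e t where "e \<in> edges G" "t \<in> {0<..<1}" "p = Inner e t"
  using assms unit_len by (auto simp: points_def)

text \<open>The edge itself is a route. For the lower bound, the function that is 1 at the head of
  \<open>e\<close>, 0 at all other vertices and affine on edges is 1-Lipschitz because edges have
  length 1, and it restricts to the coordinate on \<open>e\<close>.\<close>

lemma edge_geodesic:
  assumes e: "e \<in> edges G" and st: "s \<in> {0..1}" "t \<in> {0..1}"
  shows "path_dist G (edge_point G e s) (edge_point G e t) = \<bar>s - t\<bar>"
proof (rule antisym)
  show "path_dist G (edge_point G e s) (edge_point G e t) \<le> \<bar>s - t\<bar>"
    using route_edge[OF metric_graph e, of s t] st e unit_len edge_point_points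
    by (auto intro!: path_dist_le)
next
  define g where "g v = (if v = head G e then 1 else 0 :: real)" for v
  define h where "h x = (case x of Vertex v \<Rightarrow> g v
      | Inner e t \<Rightarrow> (1 - t) * g (tail G e) + t * g (head G e))" for x :: "('v, 'e) point"
  have h: "h (edge_point G e' r) = (1 - r) * g (tail G e') + r * g (head G e')"
    if "e' \<in> edges G" "r \<in> {0..1}" for e' r
    using that unit_len by (auto simp: edge_point_def h_def)
  have lip: "h (edge_point G e' r) \<le> h (edge_point G e' r') + \<bar>r' - r\<bar>"
    if e': "e' \<in> edges G" "r' \<in> {0..len G e'}" "r \<in> {0..len G e'}" for e' r r'
    using that unit_len no_loops h[of e' r] h[of e' r'] by (auto simp: g_def)
  have he: "h (edge_point G e r) = r" if "r \<in> {0..1}" for r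
    using h[OF e that] no_loops[OF e] by (simp add: g_def)
  have *: "r - r' \<le> path_dist G (edge_point G e r') (edge_point G e r)"
    if r: "r \<in> {0..1}" "r' \<in> {0..1}" for r r'
  proof (rule path_dist_ge[OF metric_graph])
    fix L assume "route G (edge_point G e r') L (edge_point G e r)"
    then have "h (edge_point G e r) \<le> h (edge_point G e r') + L"
      by (rule route_lipschitz[rotated]) (rule lip)
    then show "r - r' \<le> L" using he r by simp
  qed (use r e edge_point_points in auto)
  show "\<bar>s - t\<bar> \<le> path_dist G (edge_point G e s) (edge_point G e t)"
    using *[OF st] *[OF st(2,1)] commute[of "edge_point G e s" "edge_point G e t"]
    by (auto simp: abs_real_def)
qed

lemma inj_edge_point: "e \<in> edges G \<Longrightarrow> inj_on (edge_point G e) {0..1}"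
  by (rule inj_onI) (metis edge_geodesic abs_eq_0_iff right_minus_eq diff_self)

lemma continuous_edge_point:
  assumes "e \<in> edges G"
  shows "continuous_map (top_of_set {0..1}) mtopology (edge_point G e)"
  by (rule continuous_map_locally_Lipschitz)
    (use assms edge_point_points edge_geodesic in \<open>auto intro!: exI[of _ 1]\<close>)

lemma closedin_edge_image:
  assumes "e \<in> edges G" "compact I" "I \<subseteq> {0..1}"
  shows "closedin mtopology (edge_point G e ` I)"
  using assms
  by (intro compactin_imp_closedin[OF Hausdorff_space_mtopology]
      image_compactin[OF _ continuous_edge_point]) (auto simp: compactin_subtopology)

lemma connectedin_edge_image:
  assumes "e \<in> edges G" "connected I" "I \<subseteq> {0..1}"
  shows "connectedin mtopology (edge_point G e ` I)"
  using assms
  by (intro connectedin_continuous_map_image[OF continuous_edge_point])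
    (auto simp: connectedin_subtopology)

lemma points_eq_edges: "points G = (\<Union>e\<in>edges G. edge_point G e ` {0..1})"
proof (intro equalityI subsetI)
  fix p assume "p \<in> points G"
  then show "p \<in> (\<Union>e\<in>edges G. edge_point G e ` {0..1})"
  proof (cases rule: points_cases)
    case (1 v)
    have "\<not> verts G \<subseteq> {v}" using card_verts card_mono[of "{v}" "verts G"] by auto
    then obtain w where "w \<in> verts G" "v \<noteq> w" by blast
    from complete[OF 1(1) this] obtain e where
      e: "e \<in> edges G" "tail G e = v \<or> head G e = v" by auto
    then have "p = edge_point G e 0 \<or> p = edge_point G e 1" using 1 by auto
    moreover have "edge_point G e 0 \<in> edge_point G e ` {0..1}" "edge_point G e 1 \<in> edge_point G e ` {0..1}"
      by (rule imageI, simp)+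
    ultimately show ?thesis using e(1) by blast
  next
    case (2 e t)
    then have "p = edge_point G e t" "t \<in> {0..1}" by auto
    then show ?thesis using 2(1) by blast
  qed
qed (use edge_point_points in auto)

text \<open>The complement consists of the other closed edges and the rest of \<open>e\<close>, a
  finite union of compact images.\<close>

lemma openin_edge_interior:
  assumes e: "e \<in> edges G" and ab: "0 \<le> a" "b \<le> 1"
  shows "openin mtopology (edge_point G e ` {a<..<b})"
proof -
  define C where "C = (\<Union>e'\<in>edges G - {e}. edge_point G e' ` {0..1}) \<union>
     edge_point G e ` ({0..1} - {a<..<b})"
  have "compact ({0..1} - {a<..<b})" by (simp add: compact_diff)
  then have "closedin mtopology C"
    unfolding C_def using e finite_edges
    by (intro closedin_Un closedin_Union) (auto intro!: closedin_edge_image)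
  moreover have "edge_point G e ` {a<..<b} \<inter> C = {}"
  proof -
    have "edge_point G e t \<noteq> edge_point G e' t'"
      if "t \<in> {0<..<1}" "e' \<in> edges G" "e' \<noteq> e" "t' \<in> {0..1}" for t e' t'
      using that e by (auto simp: edge_point_def unit_len)
    moreover have "edge_point G e t \<noteq> edge_point G e t'"
      if "t \<in> {a<..<b}" "t' \<in> {0..1} - {a<..<b}" for t t'
      using that ab inj_onD[OF inj_edge_point[OF e], of t t'] by auto
    moreover have "{a<..<b} \<subseteq> {0<..<1}" using ab by auto
    ultimately show ?thesis unfolding C_def by blast
  qed
  moreover have "points G \<subseteq> edge_point G e ` {a<..<b} \<union> C"
    unfolding C_def using e by (auto simp: points_eq_edges)
  moreover have "edge_point G e t \<in> points G" if "t \<in> {a<..<b}" for t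
    using that ab e by (intro edge_point_points) auto
  ultimately have "edge_point G e ` {a<..<b} = points G - C" by blast
  then show ?thesis using openin_compl[OF \<open>closedin mtopology C\<close>] by simp
qed

lemma continuous_unit_arc:
  assumes "unit_arc G \<epsilon> \<gamma>"
  shows "continuous_map (top_of_set {0..\<epsilon>}) mtopology \<gamma>"
proof (rule continuous_map_locally_Lipschitz)
  show "\<gamma> ` {0..\<epsilon>} \<subseteq> points G" using assms by (simp add: unit_arc_def)
next
  fix t assume "t \<in> {0..\<epsilon>}"
  then obtain \<delta> where "\<delta> > 0" "\<forall>s\<in>{0..\<epsilon>}. \<forall>s'\<in>{0..\<epsilon>}.
        \<bar>s - t\<bar> < \<delta> \<and> \<bar>s' - t\<bar> < \<delta> \<longrightarrow> path_dist G (\<gamma> s) (\<gamma> s') = \<bar>s - s'\<bar>"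
    using assms unfolding unit_arc_def by blast
  then show "\<exists>\<delta>>0. \<forall>s\<in>{0..\<epsilon>}. \<bar>s - t\<bar> < \<delta> \<longrightarrow> path_dist G (\<gamma> t) (\<gamma> s) \<le> \<bar>s - t\<bar>"
    using \<open>t \<in> {0..\<epsilon>}\<close> by (intro exI[of _ \<delta>]) (auto simp: abs_minus_commute)
qed

lemma closedin_arc_image:
  assumes "unit_arc G \<epsilon> \<gamma>" "compact I" "I \<subseteq> {0..\<epsilon>}"
  shows "closedin mtopology (\<gamma> ` I)"
  using assms
  by (intro compactin_imp_closedin[OF Hausdorff_space_mtopology]
      image_compactin[OF _ continuous_unit_arc]) (auto simp: compactin_subtopology)

section \<open>Upper bound for the length of an arbitrary firing\<close>

lemma three_branches:
  assumes v: "v \<in> verts G" and r: "0 < r" "r < 1"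
  obtains P where "P \<subseteq> points G" "finite P" "3 \<le> card P"
    "\<And>p. p \<in> P \<Longrightarrow> path_dist G (Vertex v) p = r"
proof -
  have "\<forall>w\<in>verts G - {v}. \<exists>e\<in>edges G. (tail G e, head G e) \<in> {(v, w), (w, v)}"
    using complete[OF v] by blast
  then obtain E where E: "\<And>w. w \<in> verts G - {v} \<Longrightarrow> E w \<in> edges G"
    "\<And>w. w \<in> verts G - {v} \<Longrightarrow> (tail G (E w), head G (E w)) \<in> {(v, w), (w, v)}" by metis
  \<comment> \<open>One point on a chosen edge to each other vertex \<open>w\<close>; the two cases
    measure \<open>r\<close> from whichever end is \<open>v\<close>.\<close>
  define b :: "'v \<Rightarrow> ('v, 'e) point" where "b w = Inner (E w) (if tail G (E w) = v then r else 1 - r)" for w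
  have "inj_on b (verts G - {v})"
  proof (rule inj_onI)
    fix x y assume xy: "x \<in> verts G - {v}" "y \<in> verts G - {v}" "b x = b y"
    then have "E x = E y" by (simp add: b_def)
    then show "x = y" using E(2)[OF xy(1)] E(2)[OF xy(2)] xy by auto
  qed
  then have "card (b ` (verts G - {v})) = card (verts G) - 1"
    using v by (simp add: card_image)
  moreover have "path_dist G (Vertex v) (b w) = r" if w: "w \<in> verts G - {v}" for w
  proof (cases "tail G (E w) = v")
    case True
    then show ?thesis using edge_geodesic[OF E(1)[OF w], of 0 r] r E(1)[OF w] by (simp add: b_def)
  next
    case False
    then have "head G (E w) = v" using E(2)[OF w] by auto
    with False show ?thesis
      using edge_geodesic[OF E(1)[OF w], of 1 "1 - r"] r E(1)[OF w] by (simp add: b_def)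
  qed
  moreover have "b ` (verts G - {v}) \<subseteq> points G"
    using E(1) r by (auto simp: b_def intro!: Inner_points)
  ultimately show ?thesis
    using card_verts finite_verts by (intro that[of "b ` (verts G - {v})"]) auto
qed

text \<open>Near an interior point of a segment only two points lie at a given small distance from it,
  whereas every vertex has at least three branches.\<close>

lemma segment_avoids_vertices:
  assumes f: "is_firing G q f" and \<gamma>: "\<gamma> \<in> segs f" and t: "t \<in> {0<..<flen f}" and v: "v \<in> verts G"
  shows "\<gamma> t \<noteq> Vertex v"
proof
  assume tv: "\<gamma> t = Vertex v"
  define \<epsilon> where "\<epsilon> = flen f"
  have arc: "unit_arc G \<epsilon> \<gamma>'" if "\<gamma>' \<in> segs f" for \<gamma>'
    using f that by (auto simp: is_firing_def \<epsilon>_def)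
  have inj: "inj_on \<gamma> {0..\<epsilon>}" using arc[OF \<gamma>] by (simp add: unit_arc_def)
  have ends: "\<gamma>' 0 \<in> near f \<union> far f" "\<gamma>' \<epsilon> \<in> near f \<union> far f" if "\<gamma>' \<in> segs f" for \<gamma>'
    using f that by (auto simp: is_firing_def \<epsilon>_def)
  have compl: "points G - (near f \<union> far f) = (\<Union>\<gamma>\<in>segs f. \<gamma> ` {0<..<\<epsilon>})"
    and disj: "\<And>\<gamma>'. \<gamma>' \<in> segs f \<Longrightarrow> \<gamma>' \<noteq> \<gamma> \<Longrightarrow> \<gamma>' ` {0<..<\<epsilon>} \<inter> \<gamma> ` {0<..<\<epsilon>} = {}"
    using f \<gamma> by (auto simp: is_firing_def \<epsilon>_def disjoint_family_on_def)
  have t: "0 < t" "t < \<epsilon>" using t by (auto simp: \<epsilon>_def)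
  then obtain \<delta> where \<delta>: "\<delta> > 0" "\<And>s s'. s \<in> {0..\<epsilon>} \<Longrightarrow> s' \<in> {0..\<epsilon>} \<Longrightarrow> \<bar>s - t\<bar> < \<delta> \<Longrightarrow>
      \<bar>s' - t\<bar> < \<delta> \<Longrightarrow> path_dist G (\<gamma> s) (\<gamma> s') = \<bar>s - s'\<bar>"
    using arc[OF \<gamma>] unfolding unit_arc_def by (metis atLeastAtMost_iff less_imp_le)
  \<comment> \<open>Keeps the window around \<open>t\<close> inside the open segment and inside the
    radius on which \<open>\<gamma>\<close> is isometric.\<close>
  define \<eta> where "\<eta> = min \<delta> (min t (\<epsilon> - t))"
  have \<eta>: "\<eta> > 0" "\<eta> \<le> \<delta>" "\<eta> \<le> t" "\<eta> \<le> \<epsilon> - t" using \<delta> t by (auto simp: \<eta>_def)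
  \<comment> \<open>Everything except a short piece of \<open>\<gamma>\<close> around the vertex.
    The other segments are taken with their ends to make \<open>C\<close> closed; those ends lie in
    the near or far side anyway.\<close>
  define C where "C = near f \<union> far f \<union> (\<Union>\<gamma>'\<in>segs f - {\<gamma>}. \<gamma>' ` {0..\<epsilon>}) \<union>
    \<gamma> ` ({0..\<epsilon>} - {t - \<eta><..<t + \<eta>})"
  have "compact ({0..\<epsilon>} - {t - \<eta><..<t + \<eta>})" by (simp add: compact_diff)
  then have "closedin mtopology C"
    unfolding C_def using f \<gamma>
    by (intro closedin_Un closedin_Union) (auto simp: is_firing_def intro!: closedin_arc_image arc)
  then have "openin mtopology (points G - C)" by (rule openin_compl)
  moreover have "Vertex v \<notin> C"
  proof
    have tm: "\<gamma> t \<in> \<gamma> ` {0<..<\<epsilon>}" using t by auto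
    then have U: "\<gamma> t \<notin> near f \<union> far f" using compl \<gamma> by blast
    assume "Vertex v \<in> C"
    then consider "\<gamma> t \<in> near f \<union> far f"
      | \<gamma>' s where "\<gamma>' \<in> segs f" "\<gamma>' \<noteq> \<gamma>" "s \<in> {0..\<epsilon>}" "\<gamma> t = \<gamma>' s"
      | s where "s \<in> {0..\<epsilon>} - {t - \<eta><..<t + \<eta>}" "\<gamma> t = \<gamma> s"
      unfolding C_def tv[symmetric] by blast
    then show False
    proof cases
      case (2 \<gamma>' s)
      then have "s \<noteq> 0" "s \<noteq> \<epsilon>" using U ends[OF 2(1)] by metis+
      then have "\<gamma> t \<in> \<gamma>' ` {0<..<\<epsilon>}" using 2 by auto
      then show False using disj[OF 2(1,2)] tm by blast
    next
      case (3 s)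
      then show False using inj_onD[OF inj 3(2)] t \<eta> by auto
    qed (use U in blast)
  qed
  ultimately obtain \<rho> where \<rho>: "\<rho> > 0" "mball (Vertex v) \<rho> \<subseteq> points G - C"
    using Vertex_points[OF v] unfolding openin_mtopology by blast
  define r where "r = min \<rho> 1 / 2"
  have r: "0 < r" "r < 1" "r < \<rho>" using \<rho> by (auto simp: r_def)
  obtain P where P: "P \<subseteq> points G" "finite P" "3 \<le> card P"
    "\<And>p. p \<in> P \<Longrightarrow> path_dist G (Vertex v) p = r"
    using three_branches[OF v r(1,2)] by blast
  \<comment> \<open>Near the vertex only \<open>\<gamma>\<close> is left, and it is isometric there,
    so two points at most have distance \<open>r\<close>.\<close>
  have "P \<subseteq> \<gamma> ` {t - r, t + r}"
  proof
    fix p assume p: "p \<in> P"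
    have "p \<in> mball (Vertex v) \<rho>" using P(1) P(4)[OF p] p r Vertex_points[OF v] by auto
    then have "p \<in> points G - C" using \<rho> by blast
    then have "p \<in> points G - (near f \<union> far f)" and pC: "p \<notin> C" by (auto simp: C_def)
    then obtain \<gamma>' s where s: "\<gamma>' \<in> segs f" "s \<in> {0<..<\<epsilon>}" "p = \<gamma>' s"
      unfolding compl by blast
    then have s0: "s \<in> {0..\<epsilon>}" by simp
    have "\<gamma>' = \<gamma>"
    proof (rule ccontr)
      assume "\<gamma>' \<noteq> \<gamma>"
      then have "p \<in> (\<Union>\<gamma>'\<in>segs f - {\<gamma>}. \<gamma>' ` {0..\<epsilon>})" using s(1,3) s0 by blast
      then show False using pC by (simp add: C_def)
    qed
    then have s: "p = \<gamma> s" using s by simp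
    moreover have "p \<notin> \<gamma> ` ({0..\<epsilon>} - {t - \<eta><..<t + \<eta>})" using pC by (simp add: C_def)
    ultimately have s: "s \<in> {t - \<eta><..<t + \<eta>}" "p = \<gamma> s" using s0 by blast+
    then have "path_dist G (\<gamma> t) (\<gamma> s) = \<bar>t - s\<bar>" using \<eta> t by (intro \<delta>(2)) auto
    then have "\<bar>t - s\<bar> = r" using P(4)[OF p] tv s by simp
    then show "p \<in> \<gamma> ` {t - r, t + r}" using s by (auto simp: abs_real_def split: if_splits)
  qed
  then have "card P \<le> card (\<gamma> ` {t - r, t + r})" by (intro card_mono) auto
  also have "\<dots> \<le> 2" by (rule order.trans[OF card_image_le]) (auto simp: card_insert_if)
  finally show False using P(3) by simp
qed

text \<open>Points just before \<open>x\<close> are in neither side, hence on a segment. Its open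
  part is connected and avoids both ends of the piece from 0 to \<open>x\<close>, so it stays
  inside; an injective local isometry cannot fit an interval longer than \<open>x\<close>
  there.\<close>

lemma firing_length_le:
  assumes f: "is_firing G q f" and e: "e \<in> edges G" and x: "0 < x" "x \<le> 1"
    and far: "edge_point G e x \<in> far f"
    and not_far: "\<And>t. 0 \<le> t \<Longrightarrow> t < x \<Longrightarrow> edge_point G e t \<notin> far f"
  shows "flen f \<le> x"
proof (rule ccontr)
  assume "\<not> flen f \<le> x"
  define \<epsilon> where "\<epsilon> = flen f"
  let ?b = "edge_point G e"
  have \<epsilon>: "x < \<epsilon>" using \<open>\<not> flen f \<le> x\<close> by (simp add: \<epsilon>_def)
  have arc: "unit_arc G \<epsilon> \<gamma>'" if "\<gamma>' \<in> segs f" for \<gamma>'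
    using f that by (auto simp: is_firing_def \<epsilon>_def)
  have compl: "points G - (near f \<union> far f) = (\<Union>\<gamma>\<in>segs f. \<gamma> ` {0<..<\<epsilon>})"
    and cl: "closedin mtopology (near f)" and nf: "near f \<inter> far f = {}"
    using f by (auto simp: is_firing_def \<epsilon>_def)
  \<comment> \<open>The tail is not in the far side, and a vertex cannot be inside a
    segment.\<close>
  have b0: "?b 0 \<in> near f"
  proof (rule ccontr)
    assume "?b 0 \<notin> near f"
    then have "Vertex (tail G e) \<in> points G - (near f \<union> far f)"
      using not_far[of 0] x Vertex_points[OF tail_verts[OF e]] by auto
    then obtain \<gamma> t where "\<gamma> \<in> segs f" "t \<in> {0<..<flen f}" "\<gamma> t = Vertex (tail G e)"
      unfolding compl unfolding \<epsilon>_def by auto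
    then show False using segment_avoids_vertices[OF f _ _ tail_verts[OF e]] by blast
  qed
  have "openin mtopology (points G - near f)" "?b x \<in> points G - near f"
    using cl far nf x edge_point_points[OF e, of x]
    by (auto intro: openin_compl)
  then obtain \<rho> where \<rho>: "\<rho> > 0" "mball (?b x) \<rho> \<subseteq> points G - near f"
    unfolding openin_mtopology by blast
  \<comment> \<open>Close enough to the far point to miss the closed near side; the maximum with
    \<open>x / 2\<close> keeps it positive.\<close>
  define t where "t = max (x - \<rho> / 2) (x / 2)"
  have t: "0 < t" "t < x" "x - t < \<rho>" using \<rho> x by (auto simp: t_def)
  then have "path_dist G (?b x) (?b t) < \<rho>" using edge_geodesic[OF e, of x t] x by simp
  then have "?b t \<in> mball (?b x) \<rho>" using edge_point_points[OF e] t x by simp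
  then have "?b t \<in> points G - (near f \<union> far f)" using \<rho> not_far[of t] t by auto
  then obtain \<gamma> s where \<gamma>: "\<gamma> \<in> segs f" and s: "s \<in> {0<..<\<epsilon>}" "\<gamma> s = ?b t"
    unfolding compl by auto
  define A where "A = \<gamma> ` {0<..<\<epsilon>}"
  have A: "connectedin mtopology A"
    unfolding A_def
    by (rule connectedin_continuous_map_image[OF continuous_unit_arc[OF arc[OF \<gamma>]]])
      (auto simp: connectedin_subtopology)
  have AU: "A \<subseteq> points G - (near f \<union> far f)" unfolding compl A_def using \<gamma> by blast
  have op: "openin mtopology (?b ` {0<..<x})" "openin mtopology (points G - ?b ` {0..x})"
    using openin_edge_interior[OF e, of 0 x] closedin_edge_image[OF e, of "{0..x}"] x
    by (auto intro: openin_compl)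
  have sub: "A \<subseteq> ?b ` {0<..<x}"
  proof -
    have "A \<inter> ?b ` {0..x} \<subseteq> ?b ` {0<..<x}"
    proof
      fix p assume p: "p \<in> A \<inter> ?b ` {0..x}"
      then obtain r where r: "p = ?b r" "r \<in> {0..x}" by blast
      have "r \<noteq> 0" "r \<noteq> x" using p r b0 far AU by blast+
      then show "p \<in> ?b ` {0<..<x}" using r by auto
    qed
    then have "A \<subseteq> ?b ` {0<..<x} \<union> (points G - ?b ` {0..x})" using AU by blast
    moreover have "?b ` {0<..<x} \<inter> (points G - ?b ` {0..x}) \<inter> A = {}" by auto
    moreover have "?b ` {0<..<x} \<inter> A \<noteq> {}" using s t unfolding A_def by force
    ultimately have "(points G - ?b ` {0..x}) \<inter> A = {}"
      using connectedinD[OF A op] by blast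
    then show ?thesis using \<open>A \<subseteq> ?b ` {0<..<x} \<union> (points G - ?b ` {0..x})\<close> by blast
  qed
  then have "\<forall>r\<in>{0<..<\<epsilon>}. \<exists>u\<in>{0<..<x}. \<gamma> r = ?b u" unfolding A_def by blast
  then obtain g where g: "\<And>r. r \<in> {0<..<\<epsilon>} \<Longrightarrow> g r \<in> {0<..<x}"
    "\<And>r. r \<in> {0<..<\<epsilon>} \<Longrightarrow> \<gamma> r = ?b (g r)" by metis
  have dist: "path_dist G (\<gamma> r) (\<gamma> r') = \<bar>g r - g r'\<bar>" if "r \<in> {0<..<\<epsilon>}" "r' \<in> {0<..<\<epsilon>}" for r r'
    using edge_geodesic[OF e, of "g r" "g r'"] g(1)[OF that(1)] g(1)[OF that(2)]
      g(2)[OF that(1)] g(2)[OF that(2)] x by auto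
  have iso: "\<bar>g r - g r'\<bar> = \<bar>r - r'\<bar>" if "r \<in> {0<..<\<epsilon>}" "r' \<in> {0<..<\<epsilon>}" for r r'
  proof (rule injective_local_isometry[of "{0<..<\<epsilon>}"])
    fix r assume r: "r \<in> {0<..<\<epsilon>}"
    then have "r \<in> {0..\<epsilon>}" by auto
    then obtain \<delta> where \<delta>: "\<delta> > 0" "\<forall>s\<in>{0..\<epsilon>}. \<forall>s'\<in>{0..\<epsilon>}.
        \<bar>s - r\<bar> < \<delta> \<and> \<bar>s' - r\<bar> < \<delta> \<longrightarrow> path_dist G (\<gamma> s) (\<gamma> s') = \<bar>s - s'\<bar>"
      using arc[OF \<gamma>] unfolding unit_arc_def by blast
    show "\<exists>\<delta>>0. \<forall>s\<in>{0<..<\<epsilon>}. \<bar>s - r\<bar> < \<delta> \<longrightarrow> \<bar>g s - g r\<bar> = \<bar>s - r\<bar>"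
      using \<delta> r dist by (intro exI[of _ \<delta>]) fastforce
  next
    show "inj_on g {0<..<\<epsilon>}"
    proof (rule inj_onI)
      fix r r' assume r: "r \<in> {0<..<\<epsilon>}" "r' \<in> {0<..<\<epsilon>}" "g r = g r'"
      then have "\<gamma> r = \<gamma> r'" using g(2) by metis
      moreover have "inj_on \<gamma> {0..\<epsilon>}" using arc[OF \<gamma>] by (simp add: unit_arc_def)
      ultimately show "r = r'" using r by (auto dest: inj_onD)
    qed
  qed (use that in \<open>auto simp: is_interval_oo\<close>)
  \<comment> \<open>The two parameters below differ by \<open>\<epsilon> - d\<close>, the mean of
    \<open>\<epsilon>\<close> and \<open>x\<close>, which still exceeds \<open>x\<close>.\<close>
  define d where "d = (\<epsilon> - x) / 2"
  have d: "d / 2 \<in> {0<..<\<epsilon>}" "\<epsilon> - d / 2 \<in> {0<..<\<epsilon>}" using \<epsilon> x by (auto simp: d_def)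
  have "\<bar>g (d / 2) - g (\<epsilon> - d / 2)\<bar> < x" using g(1)[OF d(1)] g(1)[OF d(2)] by (auto simp: abs_real_def)
  moreover have "x < \<bar>d / 2 - (\<epsilon> - d / 2)\<bar>" using \<epsilon> by (simp add: d_def abs_real_def field_simps)
  ultimately show False using iso[OF d] by simp
qed

end

section \<open>Cut firings\<close>

context unit_complete_graph
begin

text \<open>A configuration \<open>x\<close> puts one chip on each edge \<open>e\<close>, at distance \<open>x e\<close> from its tail.
  The part cut out by a vertex set \<open>A\<close> reaches along every edge up to its chip.\<close>

definition part_edge :: "'v set \<Rightarrow> ('e \<Rightarrow> real) \<Rightarrow> 'e \<Rightarrow> real set" where
  "part_edge A x e =
     (if tail G e \<in> A then if head G e \<in> A then {0..1} else {0..x e}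
      else if head G e \<in> A then {x e..1} else {})"

definition part :: "'v set \<Rightarrow> ('e \<Rightarrow> real) \<Rightarrow> ('v, 'e) point set" where
  "part A x = (\<Union>e\<in>edges G. edge_point G e ` part_edge A x e)"

text \<open>A chip on the cut at the far end of its edge would pull a vertex outside \<open>A\<close> into the part.\<close>

definition proper :: "'v set \<Rightarrow> ('e \<Rightarrow> real) \<Rightarrow> bool" where
  "proper A x \<longleftrightarrow> A \<subseteq> verts G \<and> (\<forall>e\<in>edges G. 0 \<le> x e \<and> x e \<le> 1 \<and>
     (tail G e \<in> A \<longrightarrow> head G e \<notin> A \<longrightarrow> x e < 1) \<and>
     (tail G e \<notin> A \<longrightarrow> head G e \<in> A \<longrightarrow> 0 < x e))"

lemma part_edge_subset:
  assumes "proper A x" "e \<in> edges G"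
  shows "part_edge A x e \<subseteq> {0..1}"
proof -
  have "0 \<le> x e" "x e \<le> 1" using assms by (auto simp: proper_def)
  then show ?thesis by (simp add: part_edge_def)
qed

lemma vertex_edge:
  assumes "v \<in> verts G" obtains e where "e \<in> edges G" "tail G e = v \<or> head G e = v"
proof -
  have "\<not> verts G \<subseteq> {v}" using card_verts card_mono[of "{v}" "verts G"] by auto
  then obtain w where "w \<in> verts G" "v \<noteq> w" by blast
  from complete[OF assms this] show ?thesis using that by auto
qed

lemma Vertex_in_part:
  assumes x: "proper A x" and v: "v \<in> verts G"
  shows "Vertex v \<in> part A x \<longleftrightarrow> v \<in> A"
proof
  assume "Vertex v \<in> part A x"
  then obtain e t where e: "e \<in> edges G" "t \<in> part_edge A x e" "Vertex v = edge_point G e t"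
    unfolding part_def by blast
  then have "t = 0 \<and> v = tail G e \<or> t = 1 \<and> v = head G e"
    using part_edge_subset[OF x e(1)] unit_len by (auto simp: edge_point_def split: if_splits)
  then show "v \<in> A"
    using e(1,2) x by (fastforce simp: part_edge_def proper_def split: if_splits)
next
  assume "v \<in> A"
  obtain e where e: "e \<in> edges G" "tail G e = v \<or> head G e = v" using vertex_edge[OF v] .
  then have "(0 \<in> part_edge A x e \<and> v = tail G e) \<or> (1 \<in> part_edge A x e \<and> v = head G e)"
    using \<open>v \<in> A\<close> x by (auto simp: part_edge_def proper_def)
  moreover have "edge_point G e t \<in> part A x" if "t \<in> part_edge A x e" for t
    using that e(1) unfolding part_def by blast
  ultimately show "Vertex v \<in> part A x" using e(1) by (metis edge_point_simps(1,2))
qed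

text \<open>A vertex could enter the part along another edge, so the ends of \<open>e\<close> are
  decided by \<open>Vertex_in_part\<close>; an inner point lies on one edge only.\<close>

lemma edge_point_in_part:
  assumes x: "proper A x" and e: "e \<in> edges G" and t: "t \<in> {0..1}"
  shows "edge_point G e t \<in> part A x \<longleftrightarrow> t \<in> part_edge A x e"
proof -
  have bounds: "0 \<le> x e" "x e \<le> 1" "tail G e \<in> A \<Longrightarrow> head G e \<notin> A \<Longrightarrow> x e < 1"
    "tail G e \<notin> A \<Longrightarrow> head G e \<in> A \<Longrightarrow> 0 < x e"
    using x e by (auto simp: proper_def)
  consider "t = 0" | "t = 1" | "t \<in> {0<..<1}" using t by fastforce
  then show ?thesis
  proof cases
    case 1
    then show ?thesis
      using Vertex_in_part[OF x tail_verts[OF e]] bounds by (auto simp: part_edge_def)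
  next
    case 2
    then show ?thesis
      using Vertex_in_part[OF x head_verts[OF e]] bounds e by (auto simp: part_edge_def)
  next
    case 3
    have "s = t" if "e' \<in> edges G" "s \<in> part_edge A x e'" "edge_point G e t = edge_point G e' s"
      and "e' = e" for e' s
      using part_edge_subset[OF x e] that t inj_onD[OF inj_edge_point[OF e]] by blast
    moreover have "e' = e" if "e' \<in> edges G" "s \<in> part_edge A x e'" "edge_point G e t = edge_point G e' s"
      for e' s
      using that 3 e by (auto simp: edge_point_def unit_len split: if_splits)
    ultimately show ?thesis using e unfolding part_def by blast
  qed
qed

lemma closedin_part:
  assumes "proper A x"
  shows "closedin mtopology (part A x)"
proof -
  have "compact (part_edge A x e)" for e by (simp add: part_edge_def)
  then have "closedin mtopology (edge_point G e ` part_edge A x e)" if "e \<in> edges G" for e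
    using closedin_edge_image[OF that] part_edge_subset[OF assms that] by blast
  then show ?thesis
    unfolding part_def using finite_edges by (intro closedin_Union) auto
qed

text \<open>The pieces meeting a vertex \<open>w\<close> of \<open>A\<close> form a connected star.
  By completeness the edge from \<open>w\<close> to a fixed \<open>v\<close> in \<open>A\<close>
  lies in this star, so all stars share \<open>v\<close>.\<close>

lemma connectedin_part:
  assumes x: "proper A x" and A: "A \<noteq> {}"
  shows "connectedin mtopology (part A x)"
proof -
  obtain v where v: "v \<in> A" using A by blast
  have AV: "A \<subseteq> verts G" using x by (simp add: proper_def)
  define P where "P e = edge_point G e ` part_edge A x e" for e
  have P: "connectedin mtopology (P e)" if "e \<in> edges G" for e
    unfolding P_def using connectedin_edge_image[OF that] part_edge_subset[OF x that]
    by (auto simp: part_edge_def)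
  have PA: "Vertex w \<in> P e" if "e \<in> edges G" "w \<in> A" "tail G e = w \<or> head G e = w" for e w
  proof -
    have "0 \<in> part_edge A x e \<and> w = tail G e \<or> 1 \<in> part_edge A x e \<and> w = head G e"
      using that x by (auto simp: part_edge_def proper_def)
    then show ?thesis unfolding P_def using that(1) by (metis edge_point_simps(1,2) imageI)
  qed
  define C where "C w = \<Union> (P ` {e \<in> edges G. (tail G e = w \<or> head G e = w)})" for w
  have C: "connectedin mtopology (C w)" if "w \<in> A" for w
    unfolding C_def
  proof (rule connectedin_Union)
    have "Vertex w \<in> \<Inter> (P ` {e \<in> edges G. tail G e = w \<or> head G e = w})"
      using PA[OF _ that] by blast
    then show "\<Inter> (P ` {e \<in> edges G. tail G e = w \<or> head G e = w}) \<noteq> {}" by blast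
  qed (use P in auto)
  have vC: "\<exists>p. connectedin mtopology p \<and> C w \<subseteq> p \<and> p \<subseteq> part A x \<and> Vertex v \<in> p" if w: "w \<in> A" for w
  proof -
    have sub: "C u \<subseteq> part A x" for u by (auto simp: C_def part_def P_def)
    have v_in: "Vertex u \<in> C u" if "u \<in> A" for u
    proof -
      have "u \<in> verts G" using that AV by blast
      then obtain e where "e \<in> edges G" "tail G e = u \<or> head G e = u" using vertex_edge by metis
      then show ?thesis using PA that unfolding C_def by blast
    qed
    show ?thesis
    proof (cases "w = v")
      case True
      then show ?thesis using C[OF v] sub v_in[OF v] by blast
    next
      case False
      then obtain e where e: "e \<in> edges G" "(tail G e, head G e) \<in> {(w, v), (v, w)}"
        using complete[of w v] AV v w by blast
      then have "Vertex v \<in> C w" using PA[OF e(1) v] unfolding C_def by blast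
      then show ?thesis using C[OF w] sub by blast
    qed
  qed
  have "part A x = \<Union> {p. connectedin mtopology p \<and> p \<subseteq> part A x \<and> Vertex v \<in> p}"
  proof
    show "part A x \<subseteq> \<Union> {p. connectedin mtopology p \<and> p \<subseteq> part A x \<and> Vertex v \<in> p}"
    proof
      fix p assume "p \<in> part A x"
      then obtain e where e: "e \<in> edges G" "p \<in> P e" unfolding part_def P_def by blast
      then have "part_edge A x e \<noteq> {}" unfolding P_def by blast
      then obtain w where w: "w \<in> A" "tail G e = w \<or> head G e = w"
        by (auto simp: part_edge_def split: if_splits)
      then have "p \<in> C w" using e unfolding C_def by blast
      then show "p \<in> \<Union> {p. connectedin mtopology p \<and> p \<subseteq> part A x \<and> Vertex v \<in> p}"
        using vC[OF w(1)] by blast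
    qed
  qed blast
  moreover have "connectedin mtopology \<dots>" by (rule connectedin_Union) blast+
  ultimately show ?thesis by simp
qed

text \<open>Positions are measured from the tail and chips are pushed out of \<open>S\<close>,
  whence the signs.\<close>

definition shift :: "'v set \<Rightarrow> real \<Rightarrow> 'e \<Rightarrow> real" where
  "shift S \<epsilon> e = \<epsilon> * (of_bool (tail G e \<in> S) - of_bool (head G e \<in> S))"

definition cut :: "'v set \<Rightarrow> 'e set" where
  "cut S = {e \<in> edges G. (tail G e \<in> S) \<noteq> (head G e \<in> S)}"

text \<open>Here \<open>x'\<close> is the configuration after the firing: the arc starts at the
  landing place and runs back to the old position, the near-to-far orientation that
  \<open>is_firing\<close> asks for.\<close>

definition cut_arc :: "'v set \<Rightarrow> ('e \<Rightarrow> real) \<Rightarrow> 'e \<Rightarrow> real \<Rightarrow> ('v, 'e) point" where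
  "cut_arc S x' e t = edge_point G e (x' e - shift S t e)"

definition cut_firing :: "'v set \<Rightarrow> ('e \<Rightarrow> real) \<Rightarrow> real \<Rightarrow> ('v, 'e) firing" where
  "cut_firing S x \<epsilon> = (let x' = (\<lambda>e. x e + shift S \<epsilon> e) in
     \<lparr>near = part (verts G - S) x', far = part S x, flen = \<epsilon>, segs = cut_arc S x' ` cut S\<rparr>)"

definition chips :: "('e \<Rightarrow> real) \<Rightarrow> ('v, 'e) divisor" where
  "chips x = (\<Sum>e\<in>edges G. frag_of (edge_point G e (x e)))"

lemma lookup_chips_nonneg: "0 \<le> Poly_Mapping.lookup (chips x) p"
  unfolding chips_def Poly_Mapping.lookup_sum by (auto intro!: sum_nonneg simp: lookup_single when_def)

context
  fixes S :: "'v set" and x x' :: "'e \<Rightarrow> real" and \<epsilon> :: real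
  assumes S: "S \<subseteq> verts G" and \<epsilon>: "0 < \<epsilon>"
    and x: "\<And>e. e \<in> edges G \<Longrightarrow> x e \<in> {0..1}"
    and x': "\<And>e. e \<in> edges G \<Longrightarrow> x' e \<in> {0..1}"
    and x'_eq: "\<And>e. x' e = x e + shift S \<epsilon> e"
begin

text \<open>A chip on the cut still has to move by \<open>\<epsilon>\<close> within its edge, so it
  cannot already be at the end outside \<open>S\<close>. Read backwards, the same argument gives
  \<open>proper_near\<close>.\<close>

lemma proper_far: "proper S x"
  unfolding proper_def
proof (intro conjI ballI S)
  fix e assume e: "e \<in> edges G"
  show "0 \<le> x e" "x e \<le> 1" using x[OF e] by auto
  show "tail G e \<in> S \<longrightarrow> head G e \<notin> S \<longrightarrow> x e < 1"
    "tail G e \<notin> S \<longrightarrow> head G e \<in> S \<longrightarrow> 0 < x e"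
    using x'[OF e] x'_eq[of e] \<epsilon> by (auto simp: shift_def)
qed

lemma proper_near: "proper (verts G - S) x'"
  unfolding proper_def
proof (intro conjI ballI)
  fix e assume e: "e \<in> edges G"
  show "0 \<le> x' e" "x' e \<le> 1" using x'[OF e] by auto
  show "tail G e \<in> verts G - S \<longrightarrow> head G e \<notin> verts G - S \<longrightarrow> x' e < 1"
    "tail G e \<notin> verts G - S \<longrightarrow> head G e \<in> verts G - S \<longrightarrow> 0 < x' e"
    using x[OF e] x'_eq[of e] \<epsilon> tail_verts[OF e] head_verts[OF e] by (auto simp: shift_def)
qed blast

text \<open>The sign \<open>\<sigma>\<close> is the direction of the arc along its edge, so that
  both orientations of a cut edge are handled at once.\<close>

lemma cut_arc_shift:
  assumes "e \<in> cut S"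
  obtains \<sigma> where "\<bar>\<sigma>\<bar> = 1" "\<And>t. cut_arc S x' e t = edge_point G e (x' e + \<sigma> * t)" "x e = x' e + \<sigma> * \<epsilon>"
    "\<sigma> = 1 \<and> tail G e \<notin> S \<and> head G e \<in> S \<or> \<sigma> = - 1 \<and> tail G e \<in> S \<and> head G e \<notin> S"
proof (cases "tail G e \<in> S")
  case True
  then show ?thesis
    by (intro that[of "-1"]) (use assms x'_eq[of e] in \<open>auto simp: cut_def cut_arc_def shift_def\<close>)
next
  case False
  then show ?thesis
    by (intro that[of 1]) (use assms x'_eq[of e] in \<open>auto simp: cut_def cut_arc_def shift_def\<close>)
qed

lemma cut_arc_range:
  assumes "e \<in> cut S" "t \<in> {0..\<epsilon>}"
  shows "x' e - shift S t e \<in> {0..1}"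
  using assms x[of e] x'[of e] x'_eq[of e] unfolding cut_def shift_def by auto

text \<open>Inner points remember their edge; this makes the segments disjoint and distinct for
  distinct cut edges.\<close>

lemma cut_arc_interior:
  assumes e: "e \<in> cut S" and t: "t \<in> {0<..<\<epsilon>}"
  shows "cut_arc S x' e t = Inner e (x' e - shift S t e)" "x' e - shift S t e \<in> {0<..<1}"
proof -
  show *: "x' e - shift S t e \<in> {0<..<1}"
    using assms x[of e] x'[of e] x'_eq[of e] unfolding cut_def shift_def by auto
  show "cut_arc S x' e t = Inner e (x' e - shift S t e)"
    unfolding cut_arc_def using * e by (simp add: cut_def)
qed

lemma unit_arc_cut_arc:
  assumes e: "e \<in> cut S"
  shows "unit_arc G \<epsilon> (cut_arc S x' e)"
proof -
  have eG: "e \<in> edges G" using e by (simp add: cut_def)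
  have dist: "path_dist G (cut_arc S x' e s) (cut_arc S x' e t) = \<bar>s - t\<bar>"
    if "s \<in> {0..\<epsilon>}" "t \<in> {0..\<epsilon>}" for s t
    unfolding cut_arc_def edge_geodesic[OF eG cut_arc_range[OF e that(1)] cut_arc_range[OF e that(2)]]
    using e by (auto simp: shift_def cut_def)
  moreover have "cut_arc S x' e ` {0..\<epsilon>} \<subseteq> points G"
    using cut_arc_range[OF e] edge_point_points[OF eG] by (auto simp: cut_arc_def)
  moreover have "inj_on (cut_arc S x' e) {0..\<epsilon>}"
    by (rule inj_onI) (metis dist abs_eq_0_iff diff_self right_minus_eq)
  ultimately show ?thesis unfolding unit_arc_def by (auto intro!: exI[of _ 1])
qed

lemma cut_arc_ends:
  assumes e: "e \<in> cut S"
  shows "cut_arc S x' e 0 = edge_point G e (x' e)" "cut_arc S x' e \<epsilon> = edge_point G e (x e)"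
  using x'_eq[of e] by (simp_all add: cut_arc_def shift_def)

lemma near_far_complement:
  "points G - (part (verts G - S) x' \<union> part S x) = (\<Union>e\<in>cut S. cut_arc S x' e ` {0<..<\<epsilon>})"
proof (intro equalityI subsetI)
  fix p assume p: "p \<in> points G - (part (verts G - S) x' \<union> part S x)"
  then have "p \<in> points G" by blast
  then show "p \<in> (\<Union>e\<in>cut S. cut_arc S x' e ` {0<..<\<epsilon>})"
  proof (cases rule: points_cases)
    case (1 v)
    then show ?thesis
      using p Vertex_in_part[OF proper_far 1(1)] Vertex_in_part[OF proper_near 1(1)] by auto
  next
    case (2 e t)
    then have t: "t \<in> {0..1}" "p = edge_point G e t" by auto
    have *: "t \<notin> part_edge (verts G - S) x' e" "t \<notin> part_edge S x e"
      using p edge_point_in_part[OF proper_far 2(1) t(1)] edge_point_in_part[OF proper_near 2(1) t(1)]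
      by (auto simp: t)
    then have e: "e \<in> cut S"
      using 2 t tail_verts[OF 2(1)] head_verts[OF 2(1)]
      by (auto simp: part_edge_def cut_def split: if_splits)
    obtain \<sigma> where \<sigma>: "\<bar>\<sigma>\<bar> = 1" "\<And>t. cut_arc S x' e t = edge_point G e (x' e + \<sigma> * t)"
      "x e = x' e + \<sigma> * \<epsilon>"
      "\<sigma> = 1 \<and> tail G e \<notin> S \<and> head G e \<in> S \<or> \<sigma> = - 1 \<and> tail G e \<in> S \<and> head G e \<notin> S"
      using cut_arc_shift[OF e] by metis
    then have "p = cut_arc S x' e (\<sigma> * (t - x' e))" using t by auto
    moreover have "\<sigma> * (t - x' e) \<in> {0<..<\<epsilon>}"
      using \<sigma>(3,4) * t(1) tail_verts[OF 2(1)] head_verts[OF 2(1)] by (auto simp: part_edge_def)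
    ultimately show ?thesis using e by blast
  qed
next
  fix p assume "p \<in> (\<Union>e\<in>cut S. cut_arc S x' e ` {0<..<\<epsilon>})"
  then obtain e s where e: "e \<in> cut S" and s: "s \<in> {0<..<\<epsilon>}" and p: "p = cut_arc S x' e s" by blast
  have eG: "e \<in> edges G" using e by (simp add: cut_def)
  obtain \<sigma> where \<sigma>: "\<bar>\<sigma>\<bar> = 1" "\<And>t. cut_arc S x' e t = edge_point G e (x' e + \<sigma> * t)"
      "x e = x' e + \<sigma> * \<epsilon>"
      "\<sigma> = 1 \<and> tail G e \<notin> S \<and> head G e \<in> S \<or> \<sigma> = - 1 \<and> tail G e \<in> S \<and> head G e \<notin> S"
    using cut_arc_shift[OF e] by metis
  define t where "t = x' e + \<sigma> * s"
  have t: "t \<in> {0..1}" "p = edge_point G e t"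
    using cut_arc_range[OF e, of s] s p x[OF eG] x'[OF eG] \<sigma>(2,3,4) by (auto simp: t_def)
  have "t \<notin> part_edge (verts G - S) x' e" "t \<notin> part_edge S x e"
    using \<sigma>(3,4) s tail_verts[OF eG] head_verts[OF eG] by (auto simp: part_edge_def t_def)
  then show "p \<in> points G - (part (verts G - S) x' \<union> part S x)"
    using edge_point_in_part[OF proper_far eG t(1)] edge_point_in_part[OF proper_near eG t(1)]
      edge_point_points[OF eG t(1)] t(2) by simp
qed

lemma cut_firing_eq: "cut_firing S x \<epsilon> =
  \<lparr>near = part (verts G - S) x', far = part S x, flen = \<epsilon>, segs = cut_arc S x' ` cut S\<rparr>"
proof -
  have "x' = (\<lambda>e. x e + shift S \<epsilon> e)" by (rule ext) (rule x'_eq)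
  then show ?thesis by (simp add: cut_firing_def Let_def)
qed

lemma is_firing_cut:
  assumes q: "q \<in> verts G" "q \<notin> S" and ne: "S \<noteq> {}"
  shows "is_firing G (Vertex q) (cut_firing S x \<epsilon>)"
proof -
  have 1: "part (verts G - S) x' \<inter> part S x = {}"
  proof (rule ccontr)
    assume "part (verts G - S) x' \<inter> part S x \<noteq> {}"
    then obtain p where p: "p \<in> part (verts G - S) x'" "p \<in> part S x" by blast
    then obtain e t where e: "e \<in> edges G" "t \<in> part_edge S x e" "p = edge_point G e t"
      unfolding part_def by blast
    then have t: "t \<in> {0..1}" using part_edge_subset[OF proper_far e(1)] by blast
    have "t \<in> part_edge (verts G - S) x' e" "t \<in> part_edge S x e"
      using p edge_point_in_part[OF proper_far e(1) t] edge_point_in_part[OF proper_near e(1) t] e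
      by simp_all
    then show False
      using \<epsilon> x'_eq[of e] tail_verts[OF e(1)] head_verts[OF e(1)]
      by (auto simp: part_edge_def shift_def split: if_splits)
  qed
  have 2: "Vertex q \<in> part (verts G - S) x'" using Vertex_in_part[OF proper_near q(1)] q by simp
  have 3: "part S x \<noteq> {}"
    using ne S Vertex_in_part[OF proper_far] by blast
  have 4: "cut_arc S x' e 0 \<in> part (verts G - S) x'" "cut_arc S x' e \<epsilon> \<in> part S x"
    if e: "e \<in> cut S" for e
  proof -
    have eG: "e \<in> edges G" using e by (simp add: cut_def)
    show "cut_arc S x' e 0 \<in> part (verts G - S) x'"
      unfolding cut_arc_ends[OF e] edge_point_in_part[OF proper_near eG x'[OF eG]]
      using e x'[OF eG] tail_verts[OF eG] head_verts[OF eG] by (auto simp: part_edge_def cut_def)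
    show "cut_arc S x' e \<epsilon> \<in> part S x"
      unfolding cut_arc_ends[OF e] edge_point_in_part[OF proper_far eG x[OF eG]]
      using e x[OF eG] by (auto simp: part_edge_def cut_def)
  qed
  have 5: "disjoint_family_on (\<lambda>\<gamma>. \<gamma> ` {0<..<\<epsilon>}) (cut_arc S x' ` cut S)"
    unfolding disjoint_family_on_def using cut_arc_interior(1) by auto
  have 6: "finite (cut S)" using finite_edges by (simp add: cut_def)
  have 7: "part (verts G - S) x' \<noteq> {}" "verts G - S \<noteq> {}" using 2 q by blast+
  have 8: "\<forall>\<gamma>\<in>cut_arc S x' ` cut S. unit_arc G \<epsilon> \<gamma> \<and> \<gamma> 0 \<in> part (verts G - S) x' \<and> \<gamma> \<epsilon> \<in> part S x"
    using 4 unit_arc_cut_arc by blast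
  have 9: "points G - (part (verts G - S) x' \<union> part S x) = (\<Union>\<gamma>\<in>cut_arc S x' ` cut S. \<gamma> ` {0<..<\<epsilon>})"
    unfolding near_far_complement by simp
  show ?thesis
    unfolding is_firing_def cut_firing_eq firing.simps
    by (intro conjI 1 2 3 5 7 8 9 \<epsilon> finite_imageI 6 closedin_part connectedin_part proper_near
        proper_far ne)
qed

lemma chips_firing: "chips x - firing_divisor (cut_firing S x \<epsilon>) = chips x'"
proof -
  \<comment> \<open>\<open>segs\<close> is a set of arcs, so its sum is a sum over cut edges only if
    no two edges give the same arc.\<close>
  have "inj_on (cut_arc S x') (cut S)"
  proof (rule inj_onI)
    fix e e' assume e: "e \<in> cut S" "e' \<in> cut S" "cut_arc S x' e = cut_arc S x' e'"
    have "\<epsilon> / 2 \<in> {0<..<\<epsilon>}" using \<epsilon> by simp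
    from cut_arc_interior(1)[OF e(1) this] cut_arc_interior(1)[OF e(2) this]
    show "e = e'" using fun_cong[OF e(3), of "\<epsilon> / 2"]
      by (metis point.inject(2))
  qed
  then have "firing_divisor (cut_firing S x \<epsilon>) =
      (\<Sum>e\<in>cut S. frag_of (edge_point G e (x e)) - frag_of (edge_point G e (x' e)))"
    unfolding firing_divisor_def cut_firing_eq
    by (simp add: sum.reindex cut_arc_ends)
  \<comment> \<open>Chips off the cut do not move, so their terms cancel.\<close>
  also have "\<dots> = (\<Sum>e\<in>edges G. frag_of (edge_point G e (x e)) - frag_of (edge_point G e (x' e)))"
    using finite_edges by (intro sum.mono_neutral_left) (auto simp: cut_def x'_eq shift_def)
  finally show ?thesis by (simp add: chips_def sum_subtractf)
qed

text \<open>The chip of \<open>e\<close> lands on the tail, so it started at distance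
  \<open>\<epsilon>\<close>, and the far side meets \<open>e\<close> exactly from there to the head.
  \<open>firing_length_le\<close> then applies to every firing with this far side.\<close>

theorem cut_firing_maximal:
  assumes q: "q \<in> verts G" "q \<notin> S"
    and hit: "e \<in> edges G" "tail G e \<notin> S" "head G e \<in> S" "x' e = 0"
  shows "maximal_legal_firing G (Vertex q) (chips x) (cut_firing S x \<epsilon>)"
proof -
  have "is_firing G (Vertex q) (cut_firing S x \<epsilon>)" using q hit(3) by (intro is_firing_cut) auto
  then have "legal_firing G (Vertex q) (chips x) (cut_firing S x \<epsilon>)"
    unfolding legal_firing_def chips_firing using lookup_chips_nonneg by (simp add: effective_off_def)
  moreover have "flen f \<le> \<epsilon>"
    if f: "legal_firing G (Vertex q) (chips x) f" "far f = far (cut_firing S x \<epsilon>)" for f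
  proof (rule firing_length_le[OF _ hit(1) \<epsilon>])
    have xe: "x e = \<epsilon>" using hit x'_eq[of e] by (simp add: shift_def)
    then show \<epsilon>1: "\<epsilon> \<le> 1" using x[OF hit(1)] by simp
    show "is_firing G (Vertex q) f" using f by (simp add: legal_firing_def)
    have far: "edge_point G e t \<in> far f \<longleftrightarrow> t \<in> {\<epsilon>..1}" if "t \<in> {0..1}" for t
      using edge_point_in_part[OF proper_far hit(1) that] hit xe
      by (simp add: f cut_firing_eq part_edge_def)
    show "edge_point G e \<epsilon> \<in> far f" using far[of \<epsilon>] \<epsilon> \<epsilon>1 by simp
    show "edge_point G e t \<notin> far f" if "0 \<le> t" "t < \<epsilon>" for t using far[of t] that \<epsilon>1 by simp
  qed
  moreover have "flen (cut_firing S x \<epsilon>) = \<epsilon>" by (simp add: cut_firing_eq)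
  ultimately show ?thesis unfolding maximal_legal_firing_def by (metis not_le)
qed

end

end

section \<open>Runs indexed by powers of \<open>\<omega>\<close>\<close>

text \<open>Runs of \<omega>^n steps, described without ordinals so that machines can be built by
  recursion on \<open>n\<close>; \<open>transfinite_run_exists\<close> recovers the indexed
  family.\<close>

primrec reach ::
    "(('a \<Rightarrow> real) \<Rightarrow> ('a \<Rightarrow> real) \<Rightarrow> bool) \<Rightarrow> nat \<Rightarrow> ('a \<Rightarrow> real) \<Rightarrow> ('a \<Rightarrow> real) \<Rightarrow> bool" where
  "reach R 0 F F' \<longleftrightarrow> R F F'"
| "reach R (Suc n) F F' \<longleftrightarrow>
     (\<exists>H. H 0 = F \<and> (\<forall>i. reach R n (H i) (H (Suc i))) \<and> (\<forall>v. (\<lambda>i. H i v) \<longlonglongrightarrow> F' v))"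

text \<open>This is 1 + \<omega>^(n+1) = \<omega>^(n+1): for exponent 1 the sequence is shifted by
  one place, and for larger exponents the extra step is absorbed recursively into the first
  block.\<close>

lemma reach_prepend:
  assumes "R E F" "reach R (Suc n) F F'"
  shows "reach R (Suc n) E F'"
  using assms(2)
proof (induction n arbitrary: F')
  case 0
  then obtain H where H: "H 0 = F" "\<forall>i. R (H i) (H (Suc i))" "\<forall>v. (\<lambda>i. H i v) \<longlonglongrightarrow> F' v" by auto
  define K where "K = case_nat E H"
  have "R (K i) (K (Suc i))" for i using assms(1) H by (cases i) (auto simp: K_def)
  moreover have "(\<lambda>i. K i v) \<longlonglongrightarrow> F' v" for v
    using H(3) LIMSEQ_imp_Suc[of "\<lambda>i. K i v"] by (simp add: K_def)
  ultimately show ?case by (auto simp: K_def intro!: exI[of _ K])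
next
  case (Suc n)
  then obtain H where H: "H 0 = F" "\<And>i. reach R (Suc n) (H i) (H (Suc i))"
    "\<And>v. (\<lambda>i. H i v) \<longlonglongrightarrow> F' v" using reach.simps(2) by metis
  define K where "K i = (if i = 0 then E else H i)" for i
  have "reach R (Suc n) (K i) (K (Suc i))" for i
    using Suc.IH[of "H 1"] H(1) H(2)[of 0] H(2)[of i] by (simp add: K_def del: reach.simps)
  moreover have "(\<lambda>i. K i v) \<longlonglongrightarrow> F' v" for v
    using H(3)[of v] LIMSEQ_imp_Suc[of "\<lambda>i. K i v"] LIMSEQ_Suc[of "\<lambda>i. H i v"] by (simp add: K_def)
  moreover have "K 0 = E" by (simp add: K_def)
  ultimately show ?case unfolding reach.simps(2)[of R "Suc n"] by blast
qed

section \<open>The order \<omega>^(n+1) + 1 as a chain of blocks \<omega>^n + 1 sharing end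
  points\<close>

lemma refl_omega_pow: "length xs = n \<Longrightarrow> (xs, xs) \<in> omega_pow n"
  by (induction n arbitrary: xs) (auto simp: Field_omega_pow length_Suc_conv)

lemma zero_le_omega_pow: "length xs = n \<Longrightarrow> (replicate n 0, xs) \<in> omega_pow n"
  by (induction n arbitrary: xs) (auto simp: Field_omega_pow length_Suc_conv)

lemma le_zero_omega_pow: "(xs, replicate n 0) \<in> omega_pow n \<Longrightarrow> xs = replicate n 0"
  by (induction n arbitrary: xs) (auto simp: Field_omega_pow)

abbreviation omega_pow1 :: "nat \<Rightarrow> nat list option rel" where
  "omega_pow1 n \<equiv> osucc (omega_pow n)"

lemma omega_pow_Suc_iff:
  "(i # xs, j # ys) \<in> omega_pow (Suc n) \<longleftrightarrow>
     length xs = n \<and> length ys = n \<and> (i < j \<or> i = j \<and> (xs, ys) \<in> omega_pow n)"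
  by (simp add: Field_omega_pow)

declare omega_pow.simps [simp del]

lemma omega_pow1_Some: "(Some xs, Some ys) \<in> omega_pow1 n \<longleftrightarrow> (xs, ys) \<in> omega_pow n"
  and omega_pow1_None_Some: "(None, Some ys) \<notin> omega_pow1 n"
  and omega_pow1_None: "(b, None) \<in> omega_pow1 n \<longleftrightarrow> b \<in> Field (omega_pow1 n)"
  by (auto simp: Field_osucc) (auto simp: osucc_def)

lemmas omega_pow1_simps =
  omega_pow1_Some omega_pow1_None_Some omega_pow1_None omega_pow_Suc_iff

lemma Field_omega_pow1: "Field (omega_pow1 n) = insert None (Some ` {xs. length xs = n})"
  by (simp add: Field_osucc Field_omega_pow)

lemma omega_pow1_order:
  shows omega_pow1_refl: "b \<in> Field (omega_pow1 n) \<Longrightarrow> (b, b) \<in> omega_pow1 n"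
    and omega_pow1_trans: "(b, c) \<in> omega_pow1 n \<Longrightarrow> (c, d) \<in> omega_pow1 n \<Longrightarrow> (b, d) \<in> omega_pow1 n"
    and omega_pow1_antisym: "(b, c) \<in> omega_pow1 n \<Longrightarrow> (c, b) \<in> omega_pow1 n \<Longrightarrow> b = c"
    and omega_pow1_total: "b \<in> Field (omega_pow1 n) \<Longrightarrow> c \<in> Field (omega_pow1 n) \<Longrightarrow>
      (b, c) \<in> omega_pow1 n \<or> (c, b) \<in> omega_pow1 n"
proof -
  have "Well_order (omega_pow1 n)" by (intro Well_order_osucc Well_order_omega_pow)
  then have "refl_on (Field (omega_pow1 n)) (omega_pow1 n)" "trans (omega_pow1 n)"
    "antisym (omega_pow1 n)" "total_on (Field (omega_pow1 n)) (omega_pow1 n)"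
    by (auto simp: well_order_on_def linear_order_on_def partial_order_on_def preorder_on_def)
  then show "b \<in> Field (omega_pow1 n) \<Longrightarrow> (b, b) \<in> omega_pow1 n"
    "(b, c) \<in> omega_pow1 n \<Longrightarrow> (c, d) \<in> omega_pow1 n \<Longrightarrow> (b, d) \<in> omega_pow1 n"
    "(b, c) \<in> omega_pow1 n \<Longrightarrow> (c, b) \<in> omega_pow1 n \<Longrightarrow> b = c"
    "b \<in> Field (omega_pow1 n) \<Longrightarrow> c \<in> Field (omega_pow1 n) \<Longrightarrow>
      (b, c) \<in> omega_pow1 n \<or> (c, b) \<in> omega_pow1 n"
    by (auto dest: refl_onD transD antisymD simp: total_on_def) (metis refl_onD)+
qed

text \<open>The embedding of \<open>\<omega>^n + 1\<close> onto the closed interval from \<open>\<omega>^n \<cdot> i\<close> to \<open>\<omega>^n \<cdot> (i + 1)\<close>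
  of \<open>\<omega>^(n+1) + 1\<close>.\<close>

definition block :: "nat \<Rightarrow> nat \<Rightarrow> nat list option \<Rightarrow> nat list option" where
  "block n i b = (case b of Some xs \<Rightarrow> Some (i # xs) | None \<Rightarrow> Some (Suc i # replicate n 0))"

lemma block_Field: "b \<in> Field (omega_pow1 n) \<Longrightarrow> block n i b \<in> Field (omega_pow1 (Suc n))"
  by (auto simp: Field_omega_pow1 block_def)

lemma block_le_iff:
  assumes "b \<in> Field (omega_pow1 n)" "c \<in> Field (omega_pow1 n)"
  shows "(block n i b, block n i c) \<in> omega_pow1 (Suc n) \<longleftrightarrow> (b, c) \<in> omega_pow1 n"
  using assms refl_omega_pow[of "replicate n 0" n]
  by (auto simp: block_def Field_omega_pow1 omega_pow1_simps Field_omega_pow)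

lemma block_inj: "block n i b = block n i c \<longleftrightarrow> b = c"
  by (auto simp: block_def split: option.splits)

lemma block_underS_iff:
  assumes "b \<in> Field (omega_pow1 n)" "c \<in> Field (omega_pow1 n)"
  shows "block n i b \<in> underS (omega_pow1 (Suc n)) (block n i c) \<longleftrightarrow> b \<in> underS (omega_pow1 n) c"
  using block_le_iff[OF assms] by (simp add: underS_def block_inj)

text \<open>Blocks are convex. The start of block \<open>i + 1\<close> counts as the top
  \<open>None\<close> of block \<open>i\<close>.\<close>

lemma block_interval:
  assumes b: "b \<in> Field (omega_pow1 n)" and c: "c \<in> Field (omega_pow1 n)"
    and bd: "(block n i b, d) \<in> omega_pow1 (Suc n)" and dc: "(d, block n i c) \<in> omega_pow1 (Suc n)"
  obtains a where "a \<in> Field (omega_pow1 n)" "d = block n i a"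
proof -
  have "(Some (i # replicate n 0), block n i b) \<in> omega_pow1 (Suc n)"
    using b zero_le_omega_pow
    by (auto simp: block_def Field_omega_pow1 omega_pow1_simps Field_omega_pow)
  then have lo: "(Some (i # replicate n 0), d) \<in> omega_pow1 (Suc n)"
    using bd by (rule omega_pow1_trans)
  have "(block n i c, Some (Suc i # replicate n 0)) \<in> omega_pow1 (Suc n)"
    using c refl_omega_pow[of "replicate n 0" n]
    by (auto simp: block_def Field_omega_pow1 omega_pow1_simps Field_omega_pow)
  with dc have hi: "(d, Some (Suc i # replicate n 0)) \<in> omega_pow1 (Suc n)"
    by (rule omega_pow1_trans)
  obtain j ys where d: "d = Some (j # ys)"
  proof -
    have "d \<noteq> None" using hi omega_pow1_None_Some by metis
    moreover have "d \<in> Field (omega_pow1 (Suc n))" using hi by (rule FieldI1)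
    ultimately show ?thesis using that by (auto simp: Field_omega_pow1 length_Suc_conv)
  qed
  have ys: "length ys = n" and "i \<le> j" and "j < Suc i \<or> j = Suc i \<and> (ys, replicate n 0) \<in> omega_pow n"
    using lo hi by (auto simp: d omega_pow1_simps Field_omega_pow)
  then consider "j = i" | "j = Suc i" "ys = replicate n 0" using le_zero_omega_pow by force
  then show ?thesis
  proof cases
    case 1
    then show ?thesis using ys by (intro that[of "Some ys"]) (auto simp: d block_def Field_omega_pow1)
  next
    case 2
    then show ?thesis by (intro that[of None]) (auto simp: d block_def Field_omega_pow1)
  qed
qed

text \<open>An element with a successor is not \<open>None\<close>, so it can be read as a non-top
  element of its block; its successor is then at most the top and stays in the block by
  convexity.\<close>

lemma is_succ_blockD:
  assumes "is_succ (omega_pow1 (Suc n)) b b'"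
  obtains i a a' where "is_succ (omega_pow1 n) a a'" "a \<in> Field (omega_pow1 n)"
    "a' \<in> Field (omega_pow1 n)" "b = block n i a" "b' = block n i a'"
proof -
  have bb': "b \<in> underS (omega_pow1 (Suc n)) b'"
    and least: "\<And>c. b \<in> underS (omega_pow1 (Suc n)) c \<Longrightarrow> (b', c) \<in> omega_pow1 (Suc n)"
    using assms by (auto simp: is_succ_def)
  have "b \<noteq> None"
  proof
    assume "b = None"
    then show False using bb' by (cases b') (auto simp: underS_def omega_pow1_simps)
  qed
  moreover have "b \<in> Field (omega_pow1 (Suc n))" using bb' by (auto simp: underS_def intro: FieldI1)
  ultimately obtain i xs where b: "b = Some (i # xs)" "length xs = n"
    by (auto simp: Field_omega_pow1 length_Suc_conv)
  define a where "a = Some xs"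
  have a: "b = block n i a" "a \<in> Field (omega_pow1 n)" and N: "None \<in> Field (omega_pow1 n)"
    using b by (auto simp: block_def a_def Field_omega_pow1)
  have "a \<in> underS (omega_pow1 n) None" using a(2) by (auto simp: underS_def a_def omega_pow1_simps)
  then have "(b', block n i None) \<in> omega_pow1 (Suc n)"
    using least block_underS_iff[OF a(2) N] a(1) by blast
  moreover have "(block n i a, b') \<in> omega_pow1 (Suc n)" using bb' a(1) by (simp add: underS_def)
  ultimately obtain a' where a': "a' \<in> Field (omega_pow1 n)" "b' = block n i a'"
    using block_interval[OF a(2) N] by metis
  have "is_succ (omega_pow1 n) a a'"
    unfolding is_succ_def
  proof (intro conjI allI impI)
    show "a \<in> underS (omega_pow1 n) a'" using bb' block_underS_iff[OF a(2) a'(1)] a a' by simp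
  next
    fix c assume c: "a \<in> underS (omega_pow1 n) c"
    then have cF: "c \<in> Field (omega_pow1 n)" by (auto simp: underS_def intro: FieldI2)
    then have "b \<in> underS (omega_pow1 (Suc n)) (block n i c)"
      using c block_underS_iff[OF a(2) cF] a(1) by simp
    then show "(a', c) \<in> omega_pow1 n" using least block_le_iff[OF a'(1) cF] a'(2) by blast
  qed
  then show ?thesis using that a a' by blast
qed

text \<open>Anything above \<open>block n i a\<close> is in the block or above its top, so leaving
  the block creates no smaller successor.\<close>

lemma is_succ_block:
  assumes a: "is_succ (omega_pow1 n) a c" and c: "c \<in> Field (omega_pow1 n)"
  shows "is_succ (omega_pow1 (Suc n)) (block n i a) (block n i c)"
  unfolding is_succ_def
proof (intro conjI allI impI)
  have aF: "a \<in> Field (omega_pow1 n)" using a by (auto simp: is_succ_def underS_def intro: FieldI1)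
  have N: "None \<in> Field (omega_pow1 n)" by (simp add: Field_omega_pow1)
  show "block n i a \<in> underS (omega_pow1 (Suc n)) (block n i c)"
    using a block_underS_iff[OF aF c] by (simp add: is_succ_def)
  fix d assume d: "block n i a \<in> underS (omega_pow1 (Suc n)) d"
  then have dF: "d \<in> Field (omega_pow1 (Suc n))" and ad: "(block n i a, d) \<in> omega_pow1 (Suc n)"
    by (auto simp: underS_def intro: FieldI2)
  show "(block n i c, d) \<in> omega_pow1 (Suc n)"
  proof (cases "(d, block n i None) \<in> omega_pow1 (Suc n)")
    case True
    then obtain e where e: "e \<in> Field (omega_pow1 n)" "d = block n i e"
      using block_interval[OF aF N ad] by metis
    then have "a \<in> underS (omega_pow1 n) e" using d block_underS_iff[OF aF e(1)] by simp
    then have "(c, e) \<in> omega_pow1 n" using a by (simp add: is_succ_def)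
    then show ?thesis using block_le_iff[OF c e(1)] e(2) by simp
  next
    case False
    then have "(block n i None, d) \<in> omega_pow1 (Suc n)"
      using omega_pow1_total[OF dF block_Field[OF N]] by blast
    moreover have "(block n i c, block n i None) \<in> omega_pow1 (Suc n)"
      using block_le_iff[OF c N] c by (simp add: omega_pow1_simps)
    ultimately show ?thesis by (rule omega_pow1_trans[rotated])
  qed
qed

text \<open>A limit that starts block \<open>j\<close> is read as the top of block
  \<open>j - 1\<close>, because the bottom of a block is no limit inside it. The case
  \<open>j = 0\<close> would be the zero of the whole order.\<close>

lemma is_limit_blockD:
  assumes l: "is_limit (omega_pow1 (Suc n)) l" and "l \<noteq> None"
  obtains i c where "is_limit (omega_pow1 n) c" "c \<in> Field (omega_pow1 n)" "l = block n i c"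
proof -
  have lF: "l \<in> Field (omega_pow1 (Suc n))" and nz: "\<not> is_zero (omega_pow1 (Suc n)) l"
    and ns: "\<And>a. \<not> is_succ (omega_pow1 (Suc n)) a l" using l by (auto simp: is_limit_def)
  then obtain j ys where jy: "l = Some (j # ys)" "length ys = n"
    using \<open>l \<noteq> None\<close> by (auto simp: Field_omega_pow1 length_Suc_conv)
  obtain i c where c: "c \<in> Field (omega_pow1 n)" "l = block n i c" "c \<noteq> Some (replicate n 0)"
  proof (cases "ys = replicate n 0")
    case False
    then show ?thesis
      using jy by (intro that[of "Some ys" j]) (auto simp: block_def Field_omega_pow1)
  next
    case True
    have "j \<noteq> 0"
    proof
      assume "j = 0"
      then have l0: "l = Some (replicate (Suc n) 0)" using True jy by simp
      have "underS (omega_pow1 (Suc n)) l = {}"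
      proof (rule ccontr)
        assume "underS (omega_pow1 (Suc n)) l \<noteq> {}"
        then obtain b where b: "b \<noteq> l" "(b, l) \<in> omega_pow1 (Suc n)" by (auto simp: underS_def)
        then show False
          using le_zero_omega_pow[of _ "Suc n"] unfolding l0
          by (cases b) (auto simp: omega_pow1_simps simp del: replicate_Suc)
      qed
      then show False using nz lF by (simp add: is_zero_def)
    qed
    then obtain i where "j = Suc i" by (cases j) auto
    then show ?thesis
      using jy True by (intro that[of None i]) (auto simp: block_def Field_omega_pow1)
  qed
  have "(Some (replicate n 0), c) \<in> omega_pow1 n"
    using c(1) zero_le_omega_pow by (auto simp: Field_omega_pow1 omega_pow1_simps)
  then have "\<not> is_zero (omega_pow1 n) c" using c(3) by (auto simp: is_zero_def underS_def)
  moreover have "\<not> is_succ (omega_pow1 n) a c" for a using is_succ_block[OF _ c(1)] ns c(2) by blast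
  ultimately show ?thesis using c that by (auto simp: is_limit_def)
qed

text \<open>With monotonicity, the one-sided last clause says that \<open>W l\<close> is the
  pointwise supremum, hence limit, of the earlier values.\<close>

definition transfinite_run ::
    "(('a \<Rightarrow> real) \<Rightarrow> ('a \<Rightarrow> real) \<Rightarrow> bool) \<Rightarrow> nat \<Rightarrow> (nat list option \<Rightarrow> 'a \<Rightarrow> real) \<Rightarrow> bool" where
  "transfinite_run R n W \<longleftrightarrow>
     (\<forall>b c. (b, c) \<in> omega_pow1 n \<longrightarrow> W b \<le> W c) \<and>
     (\<forall>b b'. is_succ (omega_pow1 n) b b' \<longrightarrow> R (W b) (W b')) \<and>
     (\<forall>l. is_limit (omega_pow1 n) l \<longrightarrow>
        (\<forall>v. \<forall>\<delta>>0. \<exists>b\<in>underS (omega_pow1 n) l. W l v - \<delta> < W b v))"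

lemma reach_closed:
  assumes R: "\<And>F F'. R F F' \<Longrightarrow> P F \<and> P F'"
    and closed: "\<And>H F. (\<And>i::nat. P (H i)) \<Longrightarrow> (\<And>v. (\<lambda>i. H i v) \<longlonglongrightarrow> F v) \<Longrightarrow> P F"
    and "reach R n F F'"
  shows "P F \<and> P F'"
  using assms(3)
proof (induction n arbitrary: F F')
  case (Suc n)
  then obtain H where H: "H 0 = F" "\<And>i. reach R n (H i) (H (Suc i))"
    "\<And>v. (\<lambda>i. H i v) \<longlonglongrightarrow> F' v" by auto
  then have "P (H i)" for i using Suc.IH by blast
  then show ?case using H closed by metis
qed (use R in simp)

text \<open>The runs of the blocks are glued; the top value of each is the first value of the next.
  Limits inside a block are inherited, and the limit at the top comes from the convergence in
  \<open>reach\<close>.\<close>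

lemma transfinite_run_exists:
  assumes mono: "\<And>F F'. R F F' \<Longrightarrow> F \<le> F'"
    and inv: "\<And>F F'. R F F' \<Longrightarrow> P F \<and> P F'"
      "\<And>H F. (\<And>i::nat. P (H i)) \<Longrightarrow> (\<And>v. (\<lambda>i. H i v) \<longlonglongrightarrow> F v) \<Longrightarrow> P F"
    and "reach R n F F'"
  shows "\<exists>W. transfinite_run R n W \<and> (\<forall>b\<in>Field (omega_pow1 n). P (W b)) \<and>
    W (Some (replicate n 0)) = F \<and> W None = F'"
  using assms(4)
proof (induction n arbitrary: F F')
  case 0
  define W where "W b = (if b = None then F' else F)" for b :: "nat list option"
  have o: "omega_pow1 0 = {(Some [], Some []), (Some [], None), (None, None)}"
    by (auto simp: osucc_def Field_def omega_pow.simps)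
  have us: "is_succ (omega_pow1 0) (Some []) None"
    unfolding o by (auto simp: is_succ_def underS_def)
  have "F \<le> F'" using 0 mono by simp
  moreover have "b = Some [] \<and> b' = None" if "is_succ (omega_pow1 0) b b'" for b b'
    using that unfolding o by (auto simp: is_succ_def underS_def)
  moreover have "\<not> is_limit (omega_pow1 0) l" for l
  proof
    assume l: "is_limit (omega_pow1 0) l"
    then have "l = Some [] \<or> l = None" unfolding o by (auto simp: is_limit_def Field_def)
    moreover have "is_zero (omega_pow1 0) (Some [])" unfolding o by (auto simp: is_zero_def underS_def Field_def)
    ultimately show False using l us by (auto simp: is_limit_def)
  qed
  ultimately have "transfinite_run R 0 W"
    using 0 unfolding transfinite_run_def by (auto simp: W_def o)
  moreover have "P (W b)" for b using inv(1) 0 by (simp add: W_def)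
  moreover have "W (Some (replicate 0 0)) = F" "W None = F'" by (simp_all add: W_def)
  ultimately show ?case by blast
next
  case (Suc n)
  then obtain H where H: "H 0 = F" "\<And>i. reach R n (H i) (H (Suc i))"
    "\<And>v. (\<lambda>i. H i v) \<longlonglongrightarrow> F' v" by auto
  have "\<forall>i. \<exists>W. transfinite_run R n W \<and> (\<forall>b\<in>Field (omega_pow1 n). P (W b)) \<and>
      W (Some (replicate n 0)) = H i \<and> W None = H (Suc i)"
    using Suc.IH H(2) by blast
  then obtain V where V: "\<And>i. transfinite_run R n (V i)" "\<And>i. V i (Some (replicate n 0)) = H i"
    "\<And>i. V i None = H (Suc i)" and VP: "\<And>i b. b \<in> Field (omega_pow1 n) \<Longrightarrow> P (V i b)" by metis
  define W where "W b = (case b of Some xs \<Rightarrow> V (hd xs) (Some (tl xs)) | None \<Rightarrow> F')" for b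
  have WS: "W (Some (i # xs)) = V i (Some xs)" and WN: "W None = F'" for i xs by (auto simp: W_def)
  \<comment> \<open>For \<open>None\<close> this is the agreement at the junction: both values are
    \<open>H (Suc i)\<close>.\<close>
  have Wb: "W (block n i b) = V i b" for i b
    by (cases b) (auto simp: block_def W_def V)
  have V_mono: "V i b \<le> V i c" if "(b, c) \<in> omega_pow1 n" for i b c
    using V(1)[of i] that by (simp add: transfinite_run_def)
  have V_range: "H i \<le> V i (Some xs)" "V i (Some xs) \<le> H (Suc i)" if "length xs = n" for i xs
    using V_mono[of "Some (replicate n 0)" "Some xs" i] V_mono[of "Some xs" None i] that
      zero_le_omega_pow[OF that] by (auto simp: V omega_pow1_simps Field_omega_pow1)
  have H_Suc: "H i \<le> H (Suc i)" for i
    using V_range[of "replicate n 0" i] by (meson length_replicate order.trans)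
  have H_mono: "H i \<le> H j" if "i \<le> j" for i j
    using lift_Suc_mono_le[of H, OF H_Suc that] .
  have H_le: "H i \<le> F'" for i
  proof (rule le_funI)
    fix v
    have "incseq (\<lambda>i. H i v)" using H_Suc by (intro incseq_SucI) (simp add: le_funD)
    then show "H i v \<le> F' v" using incseq_le[OF _ H(3)] by blast
  qed
  have "W b \<le> W c" if bc: "(b, c) \<in> omega_pow1 (Suc n)" for b c
  proof (cases b)
    case None
    then show ?thesis using bc by (cases c) (auto simp: omega_pow1_simps)
  next
    case (Some zs)
    have "b \<in> Field (omega_pow1 (Suc n))" "c \<in> Field (omega_pow1 (Suc n))"
      using bc by (auto intro: FieldI1 FieldI2)
    then obtain i xs where b: "b = Some (i # xs)" "length xs = n"
      using Some by (auto simp: Field_omega_pow1 length_Suc_conv)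
    show ?thesis
    proof (cases c)
      case None
      then show ?thesis using b V_range(2)[of xs i] H_le[of "Suc i"] by (simp add: WS WN)
    next
      case (Some ws)
      then obtain j ys where c: "c = Some (j # ys)" "length ys = n"
        using \<open>c \<in> Field (omega_pow1 (Suc n))\<close> by (auto simp: Field_omega_pow1 length_Suc_conv)
      then consider "i < j" | "i = j" "(xs, ys) \<in> omega_pow n"
        using bc b by (auto simp: omega_pow1_simps)
      then show ?thesis
      proof cases
        case 1
        then show ?thesis
          using V_range(2)[OF b(2), of i] H_mono[of "Suc i" j] V_range(1)[OF c(2), of j]
          by (simp add: WS b c)
      next
        case 2
        then show ?thesis using V_mono[of "Some xs" "Some ys" i] by (simp add: WS b c omega_pow1_simps)
      qed
    qed
  qed
  moreover have "R (W b) (W b')" if "is_succ (omega_pow1 (Suc n)) b b'" for b b'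
    using that
  proof (rule is_succ_blockD)
    fix i a a' assume "is_succ (omega_pow1 n) a a'" "b = block n i a" "b' = block n i a'"
    then show ?thesis using V(1)[of i] by (simp add: Wb transfinite_run_def)
  qed
  moreover have "\<exists>b\<in>underS (omega_pow1 (Suc n)) l. W l v - \<delta> < W b v"
    if l: "is_limit (omega_pow1 (Suc n)) l" and \<delta>: "\<delta> > 0" for l v \<delta>
  proof (cases "l = None")
    case True
    have "\<forall>\<^sub>F i in sequentially. F' v - \<delta> < H i v"
      using order_tendstoD(1)[OF H(3)] \<delta> by simp
    then obtain i where "F' v - \<delta> < H i v" using eventually_happens by (metis sequentially_bot)
    then show ?thesis
      by (intro bexI[of _ "Some (i # replicate n 0)"])
        (auto simp: True WS WN V underS_def omega_pow1_simps Field_omega_pow1)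
  next
    case False
    obtain i c where c: "is_limit (omega_pow1 n) c" "c \<in> Field (omega_pow1 n)" "l = block n i c"
      using is_limit_blockD[OF l False] .
    then obtain b where b: "b \<in> underS (omega_pow1 n) c" "V i c v - \<delta> < V i b v"
      using V(1)[of i] \<delta> unfolding transfinite_run_def by blast
    then have "b \<in> Field (omega_pow1 n)" by (auto simp: underS_def intro: FieldI1)
    then have "block n i b \<in> underS (omega_pow1 (Suc n)) l"
      using block_underS_iff[OF _ c(2)] b(1) c(3) by blast
    then show ?thesis using b(2) c(3) by (intro bexI[of _ "block n i b"]) (simp_all add: Wb)
  qed
  ultimately have "transfinite_run R (Suc n) W" unfolding transfinite_run_def by blast
  moreover have "P (W b)" if b: "b \<in> Field (omega_pow1 (Suc n))" for b
  proof (cases b)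
    case None
    \<comment> \<open>The top value belongs to no block; it has \<open>P\<close> because
      \<open>P\<close> is closed under pointwise limits.\<close>
    have "P F \<and> P F'" by (rule reach_closed[of R P]) (fact inv Suc.prems)+
    then show ?thesis using None WN by simp
  next
    case (Some zs)
    then obtain i xs where "b = Some (i # xs)" "length xs = n"
      using b by (auto simp: Field_omega_pow1 length_Suc_conv)
    then show ?thesis using VP[of "Some xs" i] by (simp add: WS Field_omega_pow1)
  qed
  ultimately show ?case using WS WN V(2)[of 0] H(1) by (intro exI[of _ W]) simp
qed

declare reach.simps [simp del]

section \<open>Register machines\<close>

text \<open>The reciprocal of the golden ratio.\<close>

definition \<rho> :: real where "\<rho> = (sqrt 5 - 1) / 2"

lemma \<rho>_pos: "0 < \<rho>" and \<rho>_less_1: "\<rho> < 1" and \<rho>_square: "\<rho> * \<rho> = 1 - \<rho>"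
proof -
  have "1 < sqrt (5::real)" by (rule real_less_rsqrt) simp
  then show "0 < \<rho>" by (simp add: \<rho>_def)
  have "sqrt (5::real) < 3" by (rule real_less_lsqrt) simp_all
  then show "\<rho> < 1" by (simp add: \<rho>_def)
  show "\<rho> * \<rho> = 1 - \<rho>" by (simp add: \<rho>_def field_simps)
qed

lemma \<rho>_triple: "\<rho> * (\<rho> * x) = x - \<rho> * x"
  using \<rho>_square by (metis mult.assoc left_diff_distrib mult_1)

text \<open>A bound on the total firing length per unit of scale. At level 0 a round of scale
  \<open>y\<close> fires \<open>\<rho> * y\<close>. At level \<open>n + 1\<close> its two firings
  add up to \<open>y\<close>, and the lower run adds at most \<open>cost n * y\<close>. Rounds
  shrink by \<open>\<rho>\<close>, whence the factor \<open>1 / (1 - \<rho>)\<close>.\<close>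

primrec cost :: "nat \<Rightarrow> real" where
  "cost 0 = \<rho> / (1 - \<rho>)"
| "cost (Suc n) = (1 + cost n) / (1 - \<rho>)"

lemma cost_nonneg: "0 \<le> cost n"
  by (induction n) (use \<rho>_pos \<rho>_less_1 in auto)

text \<open>The interface between arithmetic and graph: the state is the potential, and registers
  are functions of it. The premise with 1/2 is the budget that keeps the idle chips on their
  edges.\<close>

locale register_machine =
  fixes R :: "('a \<Rightarrow> real) \<Rightarrow> ('a \<Rightarrow> real) \<Rightarrow> bool"
    and M :: nat
    and s :: "nat \<Rightarrow> ('a \<Rightarrow> real) \<Rightarrow> real"
  assumes op: "\<And>A B k F. A \<subseteq> {..<M} \<Longrightarrow> B \<subseteq> {..<M} \<Longrightarrow> A \<inter> B = {} \<Longrightarrow> k \<in> A \<Longrightarrow> 0 < s k F \<Longrightarrow>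
      (\<And>j. j \<in> A \<Longrightarrow> s k F \<le> s j F) \<Longrightarrow> (\<And>j. j < M \<Longrightarrow> 0 \<le> s j F) \<Longrightarrow>
      (\<And>v. 0 \<le> F v) \<Longrightarrow> (\<And>v. F v + s k F \<le> 1 / 2) \<Longrightarrow>
      \<exists>F'. R F F' \<and> (\<forall>j<M. s j F' = s j F + s k F * (of_bool (j \<in> B) - of_bool (j \<in> A))) \<and>
        (\<forall>v. F v \<le> F' v \<and> F' v \<le> F v + s k F)"
    and continuous: "\<And>H F j. (\<And>v. (\<lambda>i. H i v) \<longlonglongrightarrow> F v) \<Longrightarrow> j < M \<Longrightarrow> (\<lambda>i. s j (H i)) \<longlonglongrightarrow> s j F"
begin

definition good :: "('a \<Rightarrow> real) \<Rightarrow> bool" where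
  "good F \<longleftrightarrow> (\<forall>v. 0 \<le> F v) \<and> (\<forall>j<M. 0 \<le> s j F)"

definition ready :: "nat \<Rightarrow> real \<Rightarrow> ('a \<Rightarrow> real) \<Rightarrow> bool" where
  "ready m x F \<longleftrightarrow> good F \<and> (\<forall>j<3*m. s j F = 0) \<and>
     (\<exists>a b c. {3*m..<3*m+3} = {a, b, c} \<and> a \<noteq> b \<and> a \<noteq> c \<and> b \<noteq> c \<and>
        s a F = x \<and> s b F = \<rho> * x \<and> s c F = 0)"

lemma op_good:
  assumes "A \<subseteq> {..<M}" "B \<subseteq> {..<M}" "A \<inter> B = {}" "k \<in> A" "s k F = \<epsilon>" "0 < \<epsilon>"
    and "\<And>j. j \<in> A \<Longrightarrow> \<epsilon> \<le> s j F" "good F" "\<And>v. F v + \<epsilon> \<le> 1 / 2"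
  obtains F' where "R F F'" "good F'"
    "\<And>j. j < M \<Longrightarrow> s j F' = s j F + \<epsilon> * (of_bool (j \<in> B) - of_bool (j \<in> A))"
    "\<And>v. F v \<le> F' v" "\<And>v. F' v \<le> F v + \<epsilon>"
proof -
  from op[of A B k F] assms obtain F' where F': "R F F'"
    "\<And>j. j < M \<Longrightarrow> s j F' = s j F + \<epsilon> * (of_bool (j \<in> B) - of_bool (j \<in> A))"
    "\<And>v. F v \<le> F' v" "\<And>v. F' v \<le> F v + \<epsilon>"
    by (auto simp: good_def)
  have "0 \<le> s j F'" if "j < M" for j
    using F'(2)[OF that] assms(6,7,8) that by (auto simp: good_def)
  moreover have "0 \<le> F' v" for v using F'(3)[of v] assms(8) by (meson good_def order.trans)
  ultimately show ?thesis using that F' by (auto simp: good_def)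
qed

text \<open>If a stage of scale \<open>y\<close> raises potentials by at most \<open>K * y\<close>,
  the geometric series of all stages stays below \<open>T * x\<close>. Being monotone and bounded,
  the potentials converge.\<close>

lemma iterate:
  fixes K T x :: real
  assumes m: "3 * m + 3 \<le> M" and x: "0 < x" and K: "K = T * (1 - \<rho>)" "0 \<le> K"
    and F: "ready m x F" "\<And>v. F v + T * x \<le> 1 / 2"
    and stage: "\<And>y F. 0 < y \<Longrightarrow> ready m y F \<Longrightarrow> (\<And>v. F v + K * y \<le> 1 / 2) \<Longrightarrow>
      \<exists>F'. reach R m F F' \<and> ready m (\<rho> * y) F' \<and> (\<forall>j. 3*m+3 \<le> j \<longrightarrow> j < M \<longrightarrow> s j F' = s j F) \<and>
        (\<forall>v. F v \<le> F' v \<and> F' v \<le> F v + K * y)"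
  shows "\<exists>F'. reach R (Suc m) F F' \<and> good F' \<and> (\<forall>j<3*m+3. s j F' = 0) \<and>
     (\<forall>j. 3*m+3 \<le> j \<longrightarrow> j < M \<longrightarrow> s j F' = s j F) \<and> (\<forall>v. F v \<le> F' v \<and> F' v \<le> F v + T * x)"
proof -
  have T: "0 \<le> T" "K \<le> T"
  proof -
    show T: "0 \<le> T" using K \<rho>_less_1 by (simp add: zero_le_mult_iff)
    have "0 \<le> T * \<rho>" using T \<rho>_pos by simp
    then show "K \<le> T" using K(1) by (simp add: right_diff_distrib)
  qed
  \<comment> \<open>The last clause reserves \<open>T\<close> times the current scale for all
    remaining stages.\<close>
  define P where "P i H \<longleftrightarrow> ready m (\<rho> ^ i * x) H \<and> (\<forall>j. 3*m+3 \<le> j \<longrightarrow> j < M \<longrightarrow> s j H = s j F) \<and>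
     (\<forall>v. F v \<le> H v \<and> H v + T * (\<rho> ^ i * x) \<le> F v + T * x)" for i H
  have "\<exists>H. (\<forall>i. P i (H i)) \<and> H 0 = F \<and> (\<forall>i. reach R m (H i) (H (Suc i)) \<and> H i \<le> H (Suc i))"
  proof -
    have "\<exists>H. \<forall>i. (P i (H i) \<and> (i = 0 \<longrightarrow> H i = F)) \<and> (reach R m (H i) (H (Suc i)) \<and> H i \<le> H (Suc i))"
    proof (rule dependent_nat_choice)
      show "\<exists>H. P 0 H \<and> (0 = 0 \<longrightarrow> H = F)" using F(1) by (simp add: P_def)
    next
      fix H i assume H: "P i H \<and> (i = 0 \<longrightarrow> H = F)"
      define y where "y = \<rho> ^ i * x"
      have y: "0 < y" using x \<rho>_pos by (simp add: y_def)
      have Hv: "H v + T * y \<le> F v + T * x" "F v \<le> H v" for v using H by (auto simp: P_def y_def)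
      have KT: "K * y \<le> T * y" using T(2) y by simp
      have "H v + K * y \<le> 1 / 2" for v using Hv(1)[of v] F(2)[of v] KT by linarith
      then obtain F' where F': "reach R m H F'" "ready m (\<rho> * y) F'"
        "\<And>j. 3*m+3 \<le> j \<Longrightarrow> j < M \<Longrightarrow> s j F' = s j H"
        "\<And>v. H v \<le> F' v" "\<And>v. F' v \<le> H v + K * y"
        using stage[OF y] H unfolding P_def y_def[symmetric] by blast
      have eq: "\<rho> ^ Suc i * x = \<rho> * y" by (simp add: y_def)
      \<comment> \<open>Since \<open>K = T * (1 - \<rho>)\<close>, the price of this stage plus the
        new reserve is the old reserve.\<close>
      have "F' v + T * (\<rho> * y) \<le> F v + T * x" for v
        using F'(5)[of v] Hv(1)[of v] by (simp add: K(1) algebra_simps)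
      moreover have "F v \<le> F' v" for v using F'(4)[of v] Hv(2)[of v] by linarith
      ultimately have "P (Suc i) F'"
        unfolding P_def eq using F'(2,3) H by (auto simp: P_def)
      then show "\<exists>F'. (P (Suc i) F' \<and> (Suc i = 0 \<longrightarrow> F' = F)) \<and> reach R m H F' \<and> H \<le> F'"
        using F'(1,4) by (auto simp: le_fun_def)
    qed
    then show ?thesis by blast
  qed
  then obtain H where H: "\<And>i. P i (H i)" "H 0 = F" "\<And>i. reach R m (H i) (H (Suc i))"
    "\<And>i. H i \<le> H (Suc i)" by blast
  have Hle: "H i v \<le> F v + T * x" for i v
  proof -
    have "H i v + T * (\<rho> ^ i * x) \<le> F v + T * x" using H(1)[of i] by (simp add: P_def)
    moreover have "0 \<le> T * (\<rho> ^ i * x)" using T(1) \<rho>_pos x by simp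
    ultimately show ?thesis by linarith
  qed
  have "\<forall>v. \<exists>l. (\<lambda>i. H i v) \<longlonglongrightarrow> l"
  proof
    fix v
    have "incseq (\<lambda>i. H i v)" using H(4) by (intro incseq_SucI) (simp add: le_funD)
    moreover have "\<forall>i. H i v \<le> F v + T * x" using Hle by blast
    ultimately show "\<exists>l. (\<lambda>i. H i v) \<longlonglongrightarrow> l" using incseq_convergent by metis
  qed
  from choice[OF this] obtain F' where F': "\<And>v. (\<lambda>i. H i v) \<longlonglongrightarrow> F' v" by blast
  have bounds: "F v \<le> F' v" "F' v \<le> F v + T * x" for v
  proof -
    have "F v \<le> H i v" for i using H(1)[of i] by (simp add: P_def)
    then show "F v \<le> F' v" using LIMSEQ_le_const[OF F'[of v]] by blast
    show "F' v \<le> F v + T * x" using LIMSEQ_le_const2[OF F'[of v]] Hle by blast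
  qed
  have lim: "(\<lambda>i. s j (H i)) \<longlonglongrightarrow> s j F'" if "j < M" for j
    using continuous[OF F' that] .
  have "0 \<le> s j F'" if "j < M" for j
  proof -
    have "0 \<le> s j (H i)" for i using H(1)[of i] that by (simp add: P_def ready_def good_def)
    then show ?thesis using LIMSEQ_le_const[OF lim[OF that]] by blast
  qed
  moreover have "0 \<le> F' v" for v
    using bounds(1)[of v] F(1) by (meson good_def ready_def order.trans)
  ultimately have "good F'" by (simp add: good_def)
  moreover have "s j F' = 0" if j: "j < 3*m+3" for j
  proof -
    have jM: "j < M" using j m by simp
    have *: "0 \<le> s j (H i) \<and> s j (H i) \<le> \<rho> ^ i * x" for i
    proof -
      have rd: "ready m (\<rho> ^ i * x) (H i)" using H(1) by (simp add: P_def)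
      define y where "y = \<rho> ^ i * x"
      have y: "0 < y" using x \<rho>_pos by (simp add: y_def)
      have "\<rho> * y \<le> y" using \<rho>_less_1 y by simp
      moreover have "s j (H i) \<in> {0, y, \<rho> * y}"
      proof (cases "j < 3 * m")
        case False
        then have "j \<in> {3*m..<3*m+3}" using j by simp
        moreover obtain a b c where "{3*m..<3*m+3} = {a, b, c}"
          "s a (H i) = y" "s b (H i) = \<rho> * y" "s c (H i) = 0"
          using rd unfolding ready_def y_def[symmetric] by blast
        ultimately show ?thesis by auto
      qed (use rd in \<open>simp add: ready_def\<close>)
      ultimately show ?thesis using y \<rho>_pos unfolding y_def[symmetric] by auto
    qed
    have "(\<lambda>i. \<rho> ^ i) \<longlonglongrightarrow> 0"
      using \<rho>_pos \<rho>_less_1 by (intro LIMSEQ_realpow_zero) simp_all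
    then have "(\<lambda>i. \<rho> ^ i * x) \<longlonglongrightarrow> 0" by (rule tendsto_mult_left_zero)
    moreover have "\<forall>\<^sub>F i in sequentially. 0 \<le> s j (H i)"
      by (rule always_eventually) (use * in blast)
    moreover have "\<forall>\<^sub>F i in sequentially. s j (H i) \<le> \<rho> ^ i * x"
      by (rule always_eventually) (use * in blast)
    ultimately have "(\<lambda>i. s j (H i)) \<longlonglongrightarrow> 0"
      by (rule tendsto_sandwich[OF _ _ tendsto_const, rotated 2])
    then show ?thesis using LIMSEQ_unique lim[OF jM] by blast
  qed
  moreover have "s j F' = s j F" if "3*m+3 \<le> j" "j < M" for j
  proof -
    have "s j (H i) = s j F" for i using H(1) that by (simp add: P_def)
    then have "(\<lambda>i. s j (H i)) \<longlonglongrightarrow> s j F" by simp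
    then show ?thesis using lim[OF that(2)] LIMSEQ_unique by blast
  qed
  ultimately show ?thesis using H(2,3) F' bounds unfolding reach.simps by blast
qed

text \<open>Apply \<open>iterate\<close> at every level. A stage is one firing at level 0; above, it
  is two firings followed by a complete run of the level below, which empties its registers again
  and leaves the higher ones alone.\<close>

theorem run_level:
  assumes "3 * m + 3 \<le> M" "0 < x" "ready m x F" "\<And>v. F v + cost m * x \<le> 1 / 2"
  shows "\<exists>F'. reach R (Suc m) F F' \<and> good F' \<and> (\<forall>j<3*m+3. s j F' = 0) \<and>
     (\<forall>j. 3*m+3 \<le> j \<longrightarrow> j < M \<longrightarrow> s j F' = s j F) \<and> (\<forall>v. F v \<le> F' v \<and> F' v \<le> F v + cost m * x)"
  using assms
proof (induction m arbitrary: x F)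
  case 0
  show ?case
  proof (rule iterate[OF 0(1,2) _ _ 0(3,4)])
    show "\<rho> = cost 0 * (1 - \<rho>)" "0 \<le> \<rho>" using \<rho>_pos \<rho>_less_1 by simp_all
  next
    fix y F assume y: "0 < y" "ready 0 y F" "\<And>v. F v + \<rho> * y \<le> 1 / 2"
    then obtain a b c where abc: "{0..<3} = {a, b, c}" "a \<noteq> b" "a \<noteq> c" "b \<noteq> c"
      "s a F = y" "s b F = \<rho> * y" "s c F = 0" and good: "good F"
      by (auto simp: ready_def)
    have "a \<in> {0..<3}" "b \<in> {0..<3}" "c \<in> {0..<3}" unfolding abc(1) by auto
    then have M: "a < M" "b < M" "c < M" using 0(1) by auto
    have "0 < \<rho> * y" "\<rho> * y \<le> y" using y \<rho>_pos \<rho>_less_1 by simp_all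
    moreover from this have "\<rho> * y \<le> s j F" if "j \<in> {a, b}" for j using that abc by auto
    moreover have "{a, b} \<subseteq> {..<M}" "{c} \<subseteq> {..<M}" "{a, b} \<inter> {c} = {}" "b \<in> {a, b}"
      using M abc by auto
    ultimately obtain F' where F': "R F F'" "good F'"
      "\<And>j. j < M \<Longrightarrow> s j F' = s j F + \<rho> * y * (of_bool (j \<in> {c}) - of_bool (j \<in> {a, b}))"
      "\<And>v. F v \<le> F' v" "\<And>v. F' v \<le> F v + \<rho> * y"
      using op_good[of "{a, b}" "{c}" b F "\<rho> * y"] abc(6) good y(3) by metis
    have "ready 0 (\<rho> * y) F'"
    proof -
      \<comment> \<open>New roles: \<open>c\<close> holds \<open>\<rho> * y\<close>,
        \<open>a\<close> holds \<open>y - \<rho> * y\<close>, which is \<open>\<rho>\<close> times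
        that, and \<open>b\<close> is empty.\<close>
      have "{0..<3} = {c, a, b}" using abc(1) by blast
      moreover have "s c F' = \<rho> * y" "s a F' = \<rho> * (\<rho> * y)" "s b F' = 0"
        using F'(3)[OF M(1)] F'(3)[OF M(2)] F'(3)[OF M(3)] abc by (auto simp: \<rho>_triple)
      ultimately show ?thesis
        unfolding ready_def using abc(2-4) F'(2)
        by (intro conjI exI[of _ c] exI[of _ a] exI[of _ b]) simp_all
    qed
    moreover have "s j F' = s j F" if "3 * 0 + 3 \<le> j" "j < M" for j
    proof -
      have "j \<notin> {a, b, c}" using that unfolding abc(1)[symmetric] by simp
      then show ?thesis using F'(3)[OF that(2)] by simp
    qed
    ultimately show "\<exists>F'. reach R 0 F F' \<and> ready 0 (\<rho> * y) F' \<and>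
        (\<forall>j. 3 * 0 + 3 \<le> j \<longrightarrow> j < M \<longrightarrow> s j F' = s j F) \<and> (\<forall>v. F v \<le> F' v \<and> F' v \<le> F v + \<rho> * y)"
      using F' by (intro exI[of _ F'] conjI) (simp_all add: reach.simps)
  qed
next
  case (Suc m)
  show ?case
  proof (rule iterate[OF Suc.prems(1,2) _ _ Suc.prems(3,4)])
    show "1 + cost m = cost (Suc m) * (1 - \<rho>)" "0 \<le> 1 + cost m"
      using \<rho>_less_1 cost_nonneg[of m] by simp_all
  next
    fix y F assume y: "0 < y" "ready (Suc m) y F" "\<And>v. F v + (1 + cost m) * y \<le> 1 / 2"
    then obtain a b c where abc: "{3 * Suc m..<3 * Suc m + 3} = {a, b, c}" "a \<noteq> b" "a \<noteq> c" "b \<noteq> c"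
      "s a F = y" "s b F = \<rho> * y" "s c F = 0" and good: "good F"
      and low: "\<And>j. j < 3 * Suc m \<Longrightarrow> s j F = 0"
      by (auto simp: ready_def)
    \<comment> \<open>Two registers of level \<open>m\<close> to be loaded; the third one stays
      0.\<close>
    define p q where "p = 3 * m" and "q = 3 * m + 1"
    have "a \<in> {3 * Suc m..<3 * Suc m + 3}" "b \<in> {3 * Suc m..<3 * Suc m + 3}"
      "c \<in> {3 * Suc m..<3 * Suc m + 3}" unfolding abc(1) by auto
    then have M: "a < M" "b < M" "c < M" "p < M" "q < M" "p < 3 * Suc m" "q < 3 * Suc m"
      and ge: "3 * Suc m \<le> a" "3 * Suc m \<le> b" "3 * Suc m \<le> c"
      using Suc.prems(1) by (auto simp: p_def q_def)
    then have ne: "p \<noteq> a" "p \<noteq> b" "p \<noteq> c" "q \<noteq> a" "q \<noteq> b" "q \<noteq> c" "p \<noteq> q"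
      by (auto simp: p_def q_def)
    note ne = ne ne[symmetric]
    define z where "z = \<rho> * y"
    have z: "0 < z" "z < y" "\<rho> * z = y - z" "s b F = z"
      using y \<rho>_pos \<rho>_less_1 abc by (simp_all add: z_def \<rho>_triple)
    have "0 \<le> cost m * y" "cost m * z \<le> cost m * y"
      using cost_nonneg[of m] y z by (simp_all add: mult_left_mono)
    then have room: "F v + z \<le> 1 / 2" "F v + y \<le> 1 / 2" "F v + y + cost m * z \<le> 1 / 2" for v
      using y(3)[of v] z by (simp_all add: algebra_simps)
    have "{a, b} \<subseteq> {..<M}" "{c, p} \<subseteq> {..<M}" "{a, b} \<inter> {c, p} = {}" "b \<in> {a, b}"
      using M abc ne by auto
    moreover have "z \<le> s j F" if "j \<in> {a, b}" for j using that abc z by auto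
    \<comment> \<open>A firing adds one and the same amount to all receivers, so the loads
      \<open>z\<close> and \<open>\<rho> * z\<close> need two firings. This one gives
      \<open>z\<close> to \<open>c\<close> and \<open>p\<close>.\<close>
    ultimately obtain F1 where F1: "R F F1" "good F1"
      "\<And>j. j < M \<Longrightarrow> s j F1 = s j F + z * (of_bool (j \<in> {c, p}) - of_bool (j \<in> {a, b}))"
      "\<And>v. F v \<le> F1 v" "\<And>v. F1 v \<le> F v + z"
      using op_good[of "{a, b}" "{c, p}" b F z] z(1,4) good room(1) by metis
    have s1: "s a F1 = y - z" "s b F1 = 0" "s c F1 = z" "s p F1 = z" "s q F1 = 0"
      using F1(3)[OF M(1)] F1(3)[OF M(2)] F1(3)[OF M(3)] F1(3)[OF M(4)] F1(3)[OF M(5)]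
        abc(2-5,7) ne low[OF M(6)] low[OF M(7)] z(4) by simp_all
    have room1: "F1 v + (y - z) \<le> 1 / 2" for v using F1(5)[of v] room(2)[of v] by linarith
    have "{a} \<subseteq> {..<M}" "{b, q} \<subseteq> {..<M}" "{a} \<inter> {b, q} = {}" "a \<in> {a}"
      using M abc ne by auto
    moreover have "y - z \<le> s j F1" if "j \<in> {a}" for j using that s1 by auto
    moreover have "0 < y - z" using z by simp
    \<comment> \<open>The rest \<open>y - z = \<rho> * z\<close> of \<open>a\<close> goes to
      \<open>b\<close> and \<open>q\<close>. Now \<open>(c, b, a)\<close> and the loaded level both
      hold \<open>z\<close>, \<open>\<rho> * z\<close>, 0.\<close>
    ultimately obtain F2 where F2: "R F1 F2" "good F2"
      "\<And>j. j < M \<Longrightarrow> s j F2 = s j F1 + (y - z) * (of_bool (j \<in> {b, q}) - of_bool (j \<in> {a}))"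
      "\<And>v. F1 v \<le> F2 v" "\<And>v. F2 v \<le> F1 v + (y - z)"
      using op_good[of "{a}" "{b, q}" a F1 "y - z"] s1(1) F1(2) room1 by metis
    have s2: "s a F2 = 0" "s b F2 = y - z" "s c F2 = z" "s p F2 = z" "s q F2 = y - z"
      using F2(3)[OF M(1)] F2(3)[OF M(2)] F2(3)[OF M(3)] F2(3)[OF M(4)] F2(3)[OF M(5)]
        abc(2-4) ne s1 by simp_all
    have other: "s j F2 = s j F" if "j \<notin> {a, b, c, p, q}" "j < M" for j
      using F1(3) F2(3) that by simp
    have "ready m z F2"
    proof -
      have "{3*m..<3*m+3} = {p, q, 3*m+2}" by (auto simp: p_def q_def)
      moreover have "s (3*m+2) F2 = 0"
        using other[of "3*m+2"] low[of "3*m+2"] ge M by (simp add: p_def q_def)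
      moreover have "s j F2 = 0" if "j < 3 * m" for j
        using other[of j] low[of j] ge M that by (simp add: p_def q_def)
      ultimately show ?thesis
        unfolding ready_def using F2(2) s2 z(3)
        by (intro conjI exI[of _ p] exI[of _ q] exI[of _ "3*m+2"]) (auto simp: p_def q_def)
    qed
    moreover have "F2 v + cost m * z \<le> 1 / 2" for v
      using F1(5)[of v] F2(5)[of v] room(3)[of v] by linarith
    moreover have "3 * m + 3 \<le> M" using Suc.prems(1) by simp
    ultimately obtain F' where F': "reach R (Suc m) F2 F'" "good F'" "\<And>j. j < 3*m+3 \<Longrightarrow> s j F' = 0"
      "\<And>j. 3*m+3 \<le> j \<Longrightarrow> j < M \<Longrightarrow> s j F' = s j F2"
      "\<And>v. F2 v \<le> F' v" "\<And>v. F' v \<le> F2 v + cost m * z"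
      using Suc.IH[of z F2] z(1) by blast
    have "reach R (Suc m) F F'" using reach_prepend F1(1) F2(1) F'(1) by metis
    moreover have "ready (Suc m) z F'"
    proof -
      have "{3 * Suc m..<3 * Suc m + 3} = {c, b, a}" using abc(1) by blast
      moreover have "s c F' = z" "s b F' = \<rho> * z" "s a F' = 0"
        using F'(4) M ge s2 z(3) by simp_all
      moreover have "s j F' = 0" if "j < 3 * Suc m" for j using F'(3) that by simp
      ultimately show ?thesis unfolding ready_def using abc(2-4) F'(2) by metis
    qed
    moreover have "s j F' = s j F" if j: "3 * Suc m + 3 \<le> j" "j < M" for j
    proof -
      have "j \<notin> {3 * Suc m..<3 * Suc m + 3}" using j by simp
      then have "j \<notin> {a, b, c, p, q}" using j unfolding abc(1) by (auto simp: p_def q_def)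
      then show ?thesis using other j F'(4) by simp
    qed
    moreover have "F v \<le> F' v" for v using F1(4)[of v] F2(4)[of v] F'(5)[of v] by linarith
    moreover have "F' v \<le> F v + (1 + cost m) * y" for v
      using F1(5)[of v] F2(5)[of v] F'(6)[of v] \<open>cost m * z \<le> cost m * y\<close>
      by (simp add: algebra_simps)
    ultimately show "\<exists>F'. reach R (Suc m) F F' \<and> ready (Suc m) (\<rho> * y) F' \<and>
        (\<forall>j. 3 * Suc m + 3 \<le> j \<longrightarrow> j < M \<longrightarrow> s j F' = s j F) \<and>
        (\<forall>v. F v \<le> F' v \<and> F' v \<le> F v + (1 + cost m) * y)"
      unfolding z_def[symmetric] by blast
  qed
qed

end

section \<open>Greedy reductions from potentials\<close>

context unit_complete_graph
begin

text \<open>Firing \<open>S\<close> by length \<open>\<epsilon>\<close> raises the potential \<open>F\<close> by \<open>\<epsilon>\<close> on \<open>S\<close>; the chip on an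
  edge stays where it was, displaced by the potential difference along that edge.\<close>

definition pos :: "('e \<Rightarrow> real) \<Rightarrow> ('v \<Rightarrow> real) \<Rightarrow> 'e \<Rightarrow> real" where
  "pos x F e = x e + F (tail G e) - F (head G e)"

definition valid :: "('e \<Rightarrow> real) \<Rightarrow> ('v \<Rightarrow> real) \<Rightarrow> bool" where
  "valid x F \<longleftrightarrow> (\<forall>e\<in>edges G. pos x F e \<in> {0..1})"

text \<open>The last clause is the blocking chip required by \<open>cut_firing_maximal\<close>.
  Validity of both ends is the invariant passed to \<open>transfinite_run_exists\<close>.\<close>

definition potential_step ::
    "('e \<Rightarrow> real) \<Rightarrow> 'v \<Rightarrow> ('v \<Rightarrow> real) \<Rightarrow> ('v \<Rightarrow> real) \<Rightarrow> bool" where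
  "potential_step x q F F' \<longleftrightarrow> valid x F \<and> valid x F' \<and>
     (\<exists>S \<epsilon>. S \<subseteq> verts G - {q} \<and> 0 < \<epsilon> \<and> F' = (\<lambda>v. F v + \<epsilon> * of_bool (v \<in> S)) \<and>
        (\<exists>e\<in>edges G. tail G e \<notin> S \<and> head G e \<in> S \<and> pos x F' e = 0))"

lemma potential_step_firing:
  assumes q: "q \<in> verts G" and st: "potential_step x q F F'"
  shows "\<exists>f. maximal_legal_firing G (Vertex q) (chips (pos x F)) f \<and>
    chips (pos x F') = chips (pos x F) - firing_divisor f"
proof -
  obtain S \<epsilon> e where S: "S \<subseteq> verts G - {q}" and \<epsilon>: "0 < \<epsilon>"
    and F': "F' = (\<lambda>v. F v + \<epsilon> * of_bool (v \<in> S))"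
    and e: "e \<in> edges G" "tail G e \<notin> S" "head G e \<in> S" "pos x F' e = 0"
    and v: "valid x F" "valid x F'"
    using st unfolding potential_step_def by blast
  have v': "\<And>e. e \<in> edges G \<Longrightarrow> pos x F e \<in> {0..1}" "\<And>e. e \<in> edges G \<Longrightarrow> pos x F' e \<in> {0..1}"
    using v by (auto simp: valid_def)
  have SV: "S \<subseteq> verts G" and qS: "q \<notin> S" using S by auto
  have eq: "pos x F' e = pos x F e + shift S \<epsilon> e" for e
    by (simp add: pos_def shift_def F' algebra_simps)
  have "maximal_legal_firing G (Vertex q) (chips (pos x F)) (cut_firing S (pos x F) \<epsilon>)"
    by (rule cut_firing_maximal[OF SV \<epsilon>]) (fact v' eq q qS e)+
  moreover have "chips (pos x F') = chips (pos x F) - firing_divisor (cut_firing S (pos x F) \<epsilon>)"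
    by (rule chips_firing[OF SV \<epsilon>, symmetric]) (fact v' eq)+
  ultimately show ?thesis by blast
qed

lemma valid_limit:
  assumes "\<And>i::nat. valid x (H i)" "\<And>v. (\<lambda>i. H i v) \<longlonglongrightarrow> F v"
  shows "valid x F"
  unfolding valid_def
proof
  fix e assume e: "e \<in> edges G"
  have "(\<lambda>i. pos x (H i) e) \<longlonglongrightarrow> pos x F e"
    unfolding pos_def by (intro tendsto_intros assms(2))
  moreover have "\<forall>i. pos x (H i) e \<in> {0..1}" using assms(1) e by (auto simp: valid_def)
  ultimately show "pos x F e \<in> {0..1}" by (metis closed_atLeastAtMost closed_sequentially)
qed

lemma is_divisor_chips:
  assumes "valid x F" shows "is_divisor G (chips (pos x F))"
proof -
  have "Poly_Mapping.keys (chips (pos x F)) \<subseteq>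
      (\<Union>e\<in>edges G. Poly_Mapping.keys (frag_of (edge_point G e (pos x F e))))"
    unfolding chips_def by (rule keys_sum)
  also have "\<dots> \<subseteq> points G"
    using assms edge_point_points by (auto simp: valid_def)
  finally show ?thesis by (simp add: is_divisor_def)
qed

text \<open>A chip's position depends on two potentials, each of which increases to its value at
  \<open>l\<close>; half of \<open>\<epsilon>\<close> is allotted to each.\<close>

lemma chips_converge_potential:
  fixes W :: "nat list option \<Rightarrow> 'v \<Rightarrow> real"
  assumes W: "\<And>b c. (b, c) \<in> omega_pow1 n \<Longrightarrow> W b \<le> W c"
    and lim: "\<And>v \<delta>. \<delta> > 0 \<Longrightarrow> \<exists>b\<in>underS (omega_pow1 n) l. W l v - \<delta> < W b v"
    and valid: "\<And>b. b \<in> Field (omega_pow1 n) \<Longrightarrow> valid x (W b)"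
    and l: "l \<in> Field (omega_pow1 n)"
  shows "chips_converge G q 0 (omega_pow1 n) (\<lambda>b. chips (pos x (W b))) l"
proof -
  \<comment> \<open>Chips are labelled by their edges, a labelling that never changes.\<close>
  obtain h where h: "bij_betw h {0..<card (edges G)} (edges G)"
    using ex_bij_betw_nat_finite[OF finite_edges] by blast
  let ?x = "\<lambda>b j. edge_point G (h j) (pos x (W b) (h j))"
  have "chips (pos x (W b)) + frag_cmul 0 (frag_of q) = (\<Sum>j<card (edges G). frag_of (?x b j))" for b
    unfolding chips_def
    using sum.reindex_bij_betw[OF h, of "\<lambda>e. frag_of (edge_point G e (pos x (W b) e))"]
    by (simp add: atLeast0LessThan)
  moreover have "\<exists>b\<in>underS (omega_pow1 n) l. \<forall>c\<in>underS (omega_pow1 n) l. (b, c) \<in> omega_pow1 n \<longrightarrow>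
      path_dist G (?x c j) (?x l j) < \<epsilon>" if j: "j < card (edges G)" and \<epsilon>: "\<epsilon> > 0" for j \<epsilon>
  proof -
    define e where "e = h j"
    have e: "e \<in> edges G" using bij_betwE[OF h] j by (auto simp: e_def)
    obtain b1 b2 where b: "b1 \<in> underS (omega_pow1 n) l" "b2 \<in> underS (omega_pow1 n) l"
      and "W l (tail G e) - \<epsilon> / 2 < W b1 (tail G e)" "W l (head G e) - \<epsilon> / 2 < W b2 (head G e)"
      using lim[of "\<epsilon> / 2"] \<epsilon> by (meson half_gt_zero)
    have bF: "b1 \<in> Field (omega_pow1 n)" "b2 \<in> Field (omega_pow1 n)"
      using b by (auto simp: underS_def intro: FieldI1)
    then have "(b1, b2) \<in> omega_pow1 n \<or> (b2, b1) \<in> omega_pow1 n" by (rule omega_pow1_total)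
    then obtain b0 where b0: "b0 \<in> {b1, b2}" "(b1, b0) \<in> omega_pow1 n" "(b2, b0) \<in> omega_pow1 n"
      using omega_pow1_refl bF by blast
    have "path_dist G (?x c j) (?x l j) < \<epsilon>"
      if c: "c \<in> underS (omega_pow1 n) l" "(b0, c) \<in> omega_pow1 n" for c
    proof -
      have cl: "(c, l) \<in> omega_pow1 n" using c(1) by (simp add: underS_def)
      then have cF: "c \<in> Field (omega_pow1 n)" by (rule FieldI1)
      have "W b1 (tail G e) \<le> W c (tail G e)" "W b2 (head G e) \<le> W c (head G e)"
        using W[OF omega_pow1_trans[OF b0(2) c(2)]] W[OF omega_pow1_trans[OF b0(3) c(2)]]
        by (auto simp: le_fun_def)
      moreover have "W c (tail G e) \<le> W l (tail G e)" "W c (head G e) \<le> W l (head G e)"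
        using W[OF cl] by (auto simp: le_fun_def)
      ultimately have "\<bar>pos x (W c) e - pos x (W l) e\<bar> < \<epsilon>"
        using \<open>W l (tail G e) - \<epsilon> / 2 < W b1 (tail G e)\<close> \<open>W l (head G e) - \<epsilon> / 2 < W b2 (head G e)\<close>
        unfolding pos_def by linarith
      then show ?thesis
        using edge_geodesic[OF e, of "pos x (W c) e" "pos x (W l) e"] valid[OF cF] valid[OF l] e
        by (simp add: valid_def flip: e_def)
    qed
    moreover have "b0 \<in> underS (omega_pow1 n) l" using b0(1) b by blast
    ultimately show ?thesis by blast
  qed
  ultimately show ?thesis
    unfolding chips_converge_def by (intro exI[of _ "card (edges G)"] exI[of _ ?x]) blast
qed

theorem greedy_reduction_exists:
  assumes q: "q \<in> verts G" and "reach (potential_step x q) n F F'"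
  shows "\<exists>D Ds. is_divisor G D \<and> effective_off G (Vertex q) D \<and>
    greedy_reduction G (Vertex q) D (omega_pow n) Ds"
proof -
  have mono: "F \<le> F'" if "potential_step x q F F'" for F F'
    using that by (auto simp: potential_step_def le_fun_def)
  have inv: "valid x F \<and> valid x F'" if "potential_step x q F F'" for F F'
    using that by (simp add: potential_step_def)
  have "\<exists>W. transfinite_run (potential_step x q) n W \<and>
      (\<forall>b\<in>Field (omega_pow1 n). valid x (W b)) \<and> W (Some (replicate n 0)) = F \<and> W None = F'"
    by (rule transfinite_run_exists) (fact mono inv valid_limit assms(2))+
  then obtain W where W: "transfinite_run (potential_step x q) n W" "W (Some (replicate n 0)) = F"
    and W_valid: "\<And>b. b \<in> Field (omega_pow1 n) \<Longrightarrow> valid x (W b)"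
    by blast
  have W_mono: "W b \<le> W c" if "(b, c) \<in> omega_pow1 n" for b c
    using W(1) that by (simp add: transfinite_run_def)
  have W_step: "potential_step x q (W b) (W b')" if "is_succ (omega_pow1 n) b b'" for b b'
    using W(1) that by (simp add: transfinite_run_def)
  define Ds where "Ds b = chips (pos x (W b))" for b
  define D where "D = chips (pos x F)"
  have D_nonneg: "0 \<le> Poly_Mapping.lookup D p" for p
    unfolding D_def by (rule lookup_chips_nonneg)
  have "is_divisor G D" unfolding D_def
    using is_divisor_chips[OF W_valid[of "Some (replicate n 0)"]] W(2) by (simp add: Field_omega_pow1)
  moreover have "effective_off G (Vertex q) D" using D_nonneg by (simp add: effective_off_def)
  moreover have "greedy_reduction G (Vertex q) D (omega_pow n) Ds"
    unfolding greedy_reduction_def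
  proof (intro conjI ballI allI impI)
    show "Well_order (omega_pow n)" by (rule Well_order_omega_pow)
  next
    fix b assume "b \<in> Field (omega_pow1 n)"
    then show "is_divisor G (Ds b)" unfolding Ds_def by (intro is_divisor_chips W_valid)
  next
    fix b assume b: "is_zero (omega_pow1 n) b"
    have "(Some (replicate n 0), b) \<in> omega_pow1 n"
      using b zero_le_omega_pow by (auto simp: is_zero_def Field_omega_pow1 omega_pow1_simps)
    then have "b = Some (replicate n 0)" using b by (auto simp: is_zero_def underS_def)
    then show "Ds b = D" using W(2) by (simp add: Ds_def D_def)
  next
    fix b b' assume "is_succ (omega_pow1 n) b b'"
    then show "\<exists>f. maximal_legal_firing G (Vertex q) (Ds b) f \<and> Ds b' = Ds b - firing_divisor f"
      unfolding Ds_def by (intro potential_step_firing q W_step)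
  next
    fix l assume l: "is_limit (omega_pow1 n) l"
    \<comment> \<open>The divisor is effective at \<open>q\<close> too, so no chips have to be added
      there.\<close>
    have "max 0 (- Poly_Mapping.lookup D (Vertex q)) = 0" using D_nonneg[of "Vertex q"] by simp
    moreover have "\<exists>b\<in>underS (omega_pow1 n) l. W l v - \<delta> < W b v" if "\<delta> > 0" for v \<delta>
      using W(1) l that by (simp add: transfinite_run_def)
    moreover have "l \<in> Field (omega_pow1 n)" using l by (simp add: is_limit_def)
    ultimately show "chips_converge G (Vertex q) (max 0 (- Poly_Mapping.lookup D (Vertex q)))
        (omega_pow1 n) Ds l"
      unfolding Ds_def using chips_converge_potential[of n W l x] W_mono W_valid by simp
  qed
  ultimately show ?thesis by blast
qed

end

section \<open>The concrete complete graph and its registers\<close>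

definition complete_graph :: "nat \<Rightarrow> (nat, nat) wgraph" where
  "complete_graph N = \<lparr>verts = {..<N}, edges = prod_encode ` {(i, j). i < j \<and> j < N},
     tail = fst \<circ> prod_decode, head = snd \<circ> prod_decode, len = (\<lambda>_. 1)\<rparr>"

lemma complete_graph_simps [simp]:
  "verts (complete_graph N) = {..<N}"
  "prod_encode (i, j) \<in> edges (complete_graph N) \<longleftrightarrow> i < j \<and> j < N"
  "tail (complete_graph N) (prod_encode (i, j)) = i"
  "head (complete_graph N) (prod_encode (i, j)) = j"
  by (auto simp: complete_graph_def)

lemma complete_graph_edge_cases:
  assumes "e \<in> edges (complete_graph N)"
  obtains i j where "e = prod_encode (i, j)" "i < j" "j < N"
  using assms by (auto simp: complete_graph_def)

lemma unit_complete_graph_complete_graph: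
  assumes "4 \<le> N"
  shows "unit_complete_graph (complete_graph N)"
proof
  have "finite {(i, j). i < j \<and> j < N}"
    by (rule finite_subset[of _ "{..<N} \<times> {..<N}"]) auto
  then show "finite (edges (complete_graph N))" by (simp add: complete_graph_def)
next
  fix u v assume uv: "u \<in> verts (complete_graph N)" "v \<in> verts (complete_graph N)" "u \<noteq> v"
  then show "\<exists>e\<in>edges (complete_graph N).
      (tail (complete_graph N) e, head (complete_graph N) e) \<in> {(u, v), (v, u)}"
    by (intro bexI[of _ "prod_encode (min u v, max u v)"]) (auto simp: min_def max_def)
qed (use assms in \<open>auto elim!: complete_graph_edge_cases simp: complete_graph_def\<close>)

text \<open>Register \<open>k\<close> is the distance of the chip on the edge from \<open>2 k + 1\<close> to \<open>2 k + 2\<close> from its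
  tail. All other chips start in the middle of their edges, too far from the vertices to reach them.\<close>

definition register_chips :: "(nat \<Rightarrow> real) \<Rightarrow> nat \<Rightarrow> real" where
  "register_chips r e = (case prod_decode e of (i, j) \<Rightarrow> if odd i \<and> j = Suc i then r (i div 2) else 1 / 2)"

definition register :: "(nat \<Rightarrow> real) \<Rightarrow> nat \<Rightarrow> (nat \<Rightarrow> real) \<Rightarrow> real" where
  "register r k F = r k + F (2 * k + 1) - F (2 * k + 2)"

text \<open>The \<open>2 * M + 1\<close> vertices are the ends of \<open>M\<close> disjoint register
  edges and the basepoint 0.\<close>

lemma register_machine_complete_graph:
  fixes M :: nat and r :: "nat \<Rightarrow> real"
  defines "G \<equiv> complete_graph (2 * M + 1)"
  assumes M: "2 \<le> M" and r: "\<And>k. r k \<le> 1 / 2"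
  shows "register_machine (unit_complete_graph.potential_step G (register_chips r) 0) M (register r)"
proof -
  interpret unit_complete_graph G
    unfolding G_def by (rule unit_complete_graph_complete_graph) (use M in simp)
  have pos_edge: "pos (register_chips r) F (prod_encode (i, j)) =
      (if odd i \<and> j = Suc i then r (i div 2) else 1 / 2) + F i - F j" for F i j
    unfolding pos_def register_chips_def by (simp add: G_def)
  have valid: "valid (register_chips r) F"
    if F: "\<And>v. 0 \<le> F v" "\<And>v. F v \<le> 1 / 2" and reg: "\<And>k. k < M \<Longrightarrow> 0 \<le> register r k F" for F
    unfolding valid_def
  proof
    fix e assume "e \<in> edges G"
    then obtain i j where e: "e = prod_encode (i, j)" "i < j" "j < 2 * M + 1"
      unfolding G_def by (rule complete_graph_edge_cases)
    show "pos (register_chips r) F e \<in> {0..1}"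
    proof (cases "odd i \<and> j = Suc i")
      \<comment> \<open>Nonnegativity of the register is the lower bound; the upper bound is 1/2 for
        \<open>r k\<close> plus 1/2 for the potential at the tail.\<close>
      case True
      then obtain k where k: "i = 2 * k + 1" by (auto elim: oddE)
      then have "0 \<le> register r k F" using reg e True by simp
      then show ?thesis
        using True k r[of k] F(1)[of j] F(2)[of i] by (simp add: e(1) pos_edge register_def)
    next
      \<comment> \<open>A chip from the middle is displaced by at most 1/2.\<close>
      case False
      then show ?thesis
        using F(1)[of i] F(2)[of i] F(1)[of j] F(2)[of j] unfolding e(1) pos_edge if_not_P[OF False]
        by simp
    qed
  qed
  show ?thesis
  proof
    fix A B :: "nat set" and k :: nat and F :: "nat \<Rightarrow> real"
    let ?\<epsilon> = "register r k F"
    assume AB: "A \<subseteq> {..<M}" "B \<subseteq> {..<M}" "A \<inter> B = {}" and k: "k \<in> A" and \<epsilon>: "0 < ?\<epsilon>"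
      and min: "\<And>j. j \<in> A \<Longrightarrow> ?\<epsilon> \<le> register r j F" and reg: "\<And>j. j < M \<Longrightarrow> 0 \<le> register r j F"
      and F: "\<And>v. 0 \<le> F v" "\<And>v. F v + ?\<epsilon> \<le> 1 / 2"
    \<comment> \<open>Firing the head of a register edge lowers the register, firing its tail raises
      it.\<close>
    define S where "S = (\<lambda>j. 2 * j + 2) ` A \<union> (\<lambda>j. 2 * j + 1) ` B"
    define F' where "F' = (\<lambda>v. F v + ?\<epsilon> * of_bool (v \<in> S))"
    have S: "2 * j + 2 \<in> S \<longleftrightarrow> j \<in> A" "2 * j + 1 \<in> S \<longleftrightarrow> j \<in> B" for j
    proof -
      have *: "2 * j + 2 \<noteq> 2 * i + 1" "2 * j + 1 \<noteq> 2 * i + 2"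
        "2 * j + 2 = 2 * i + 2 \<longleftrightarrow> j = i" "2 * j + 1 = 2 * i + 1 \<longleftrightarrow> j = i" for i :: nat
        by presburger+
      show "2 * j + 2 \<in> S \<longleftrightarrow> j \<in> A" "2 * j + 1 \<in> S \<longleftrightarrow> j \<in> B"
        by (auto simp only: S_def Un_iff image_iff *)
    qed
    have reg': "register r j F' = register r j F + ?\<epsilon> * (of_bool (j \<in> B) - of_bool (j \<in> A))" for j
      using S[of j] by (simp add: register_def F'_def algebra_simps)
    have F'_bounds: "F v \<le> F' v" "F' v \<le> F v + ?\<epsilon>" for v using \<epsilon> by (simp_all add: F'_def)
    have "potential_step (register_chips r) 0 F F'"
      unfolding potential_step_def
    proof (intro conjI exI[of _ S] exI[of _ ?\<epsilon>] bexI[of _ "prod_encode (2 * k + 1, 2 * k + 2)"])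
      have "F v \<le> 1 / 2" for v using F(2)[of v] \<epsilon> by linarith
      then show "valid (register_chips r) F" using F(1) reg by (intro valid)
      have "0 \<le> register r j F'" if "j < M" for j
        using reg[OF that] min[of j] \<epsilon> AB(3) by (cases "j \<in> A") (auto simp: reg')
      moreover have "0 \<le> F' v" "F' v \<le> 1 / 2" for v
        using F'_bounds[of v] F(1)[of v] F(2)[of v] by linarith+
      ultimately show "valid (register_chips r) F'" by (intro valid)
      show "S \<subseteq> verts G - {0}" using AB(1,2) by (auto simp: S_def G_def)
      show "prod_encode (2 * k + 1, 2 * k + 2) \<in> edges G" using k AB(1) by (auto simp: G_def)
      show "tail G (prod_encode (2 * k + 1, 2 * k + 2)) \<notin> S"
        "head G (prod_encode (2 * k + 1, 2 * k + 2)) \<in> S"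
        using k AB(3) S[of k] by (auto simp: G_def)
      have "pos (register_chips r) F' (prod_encode (2 * k + 1, 2 * k + 2)) = register r k F'"
        by (simp add: pos_edge register_def)
      then show "pos (register_chips r) F' (prod_encode (2 * k + 1, 2 * k + 2)) = 0"
        using k AB(3) by (auto simp: reg')
    qed (use \<epsilon> F'_def in auto)
    then show "\<exists>F'. potential_step (register_chips r) 0 F F' \<and>
        (\<forall>j<M. register r j F' = register r j F + ?\<epsilon> * (of_bool (j \<in> B) - of_bool (j \<in> A))) \<and>
        (\<forall>v. F v \<le> F' v \<and> F' v \<le> F v + ?\<epsilon>)"
      using reg' F'_bounds by blast
  next
    fix H :: "nat \<Rightarrow> nat \<Rightarrow> real" and F j
    assume "\<And>v. (\<lambda>i. H i v) \<longlonglongrightarrow> F v"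
    then show "(\<lambda>i. register r j (H i)) \<longlonglongrightarrow> register r j F"
      unfolding register_def by (intro tendsto_intros)
  qed
qed

theorem lemma2:
  fixes n :: nat
  shows "\<exists>(G :: (nat, nat) wgraph) (q :: (nat, nat) point) (D :: (nat, nat) divisor)
            (\<alpha> :: nat list rel) (Ds :: nat list option \<Rightarrow> (nat, nat) divisor).
           metric_graph G \<and> q \<in> points G \<and>
           is_divisor G D \<and> effective_off G q D \<and>
           greedy_reduction G q D \<alpha> Ds \<and> (omega_pow n, \<alpha>) \<in> ordLeq"
proof -
  define M where "M = 3 * n + 3"
  define G where "G = complete_graph (2 * M + 1)"
  \<comment> \<open>Makes both \<open>x\<close> and \<open>cost n * x\<close> at most 1/2, the bound
    on initial registers and the budget for a run from potential 0.\<close>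
  define x where "x = 1 / (2 * (1 + cost n))"
  define r where "r k = (if k = 3 * n then x else if k = 3 * n + 1 then \<rho> * x else 0)" for k
  have x: "0 < x" "x \<le> 1 / 2" "cost n * x \<le> 1 / 2"
    using cost_nonneg[of n] by (simp_all add: x_def field_simps)
  have \<rho>x: "0 \<le> \<rho> * x" "\<rho> * x \<le> x" using x \<rho>_pos \<rho>_less_1 by simp_all
  then have "\<rho> * x \<le> 1 / 2" using x by linarith
  interpret unit_complete_graph G
    unfolding G_def by (rule unit_complete_graph_complete_graph) (simp add: M_def)
  have "r k \<le> 1 / 2" for k using x \<open>\<rho> * x \<le> 1 / 2\<close> by (simp add: r_def)
  then interpret register_machine "potential_step (register_chips r) 0" M "register r"
    unfolding G_def by (intro register_machine_complete_graph) (simp add: M_def)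
  have reg0: "register r k (\<lambda>_. 0) = r k" for k by (simp add: register_def)
  have "good (\<lambda>_. 0)" using x \<rho>x by (simp add: good_def reg0 r_def)
  moreover have "{3*n..<3*n+3} = {3*n, 3*n+1, 3*n+2}" by auto
  ultimately have "ready n x (\<lambda>_. 0)"
    unfolding ready_def reg0
    by (intro conjI exI[of _ "3*n"] exI[of _ "3*n+1"] exI[of _ "3*n+2"]) (simp_all add: r_def)
  then obtain F' where "reach (potential_step (register_chips r) 0) (Suc n) (\<lambda>_. 0) F'"
    using run_level[of n x "\<lambda>_. 0"] x by (auto simp: M_def)
  \<comment> \<open>The machine with levels 0 to \<open>n\<close> runs for \<omega>^(n+1) steps; its
    first block has \<omega>^n, which covers \<open>n = 0\<close> without a separate case.\<close>
  then obtain H where "reach (potential_step (register_chips r) 0) n (H 0) (H (Suc 0))"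
    unfolding reach.simps by blast
  moreover have q: "0 \<in> verts G" by (simp add: G_def)
  ultimately obtain D Ds where D: "is_divisor G D" "effective_off G (Vertex 0) D"
    "greedy_reduction G (Vertex 0) D (omega_pow n) Ds"
    using greedy_reduction_exists by blast
  moreover have "(omega_pow n, omega_pow n) \<in> ordLeq"
    using Well_order_omega_pow by (rule ordLeq_reflexive)
  ultimately show ?thesis using metric_graph Vertex_points[OF q] by blast
qed

end
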